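(* Let $1\le p\le2\le q\le\infty$, and suppose that neither $p=q=2$ nor ($p=1$ and $q=\infty$) holds. Let $U=\bigoplus_{n=1}^\infty U_n\colon\ell_p\to\ell_q$ be the block Hadamard operator, where $U_n=N^{-1/\min\{p',q\}}H_n\colon\ell_p^N\to\ell_q^N$ with $N=2^n$ and $H_n$ is the $2^n\times2^n$ Hadamard matrix. Then $U$ is finitely strictly singular.
   Context: $p'$ is the conjugate exponent of $p$, $\frac1p+\frac1{p'}=1$ (with $1'=\infty$, $1/\infty=0$). The Hadamard matrices are defined by $H_0=(1)$ and $H_{n+1}=\begin{pmatrix}H_n&H_n\\H_n&-H_n\end{pmatrix}$, so $H_n$ is $2^n\times2^n$. One identifies $\ell_p=\bigl(\bigoplus_{n=1}^\infty\ell_p^{2^n}\bigr)_p$ and $\ell_q=\bigl(\bigoplus_{n=1}^\infty\ell_q^{2^n}\bigr)_q$ via consecutive blocks of coordinates, and $U$ acts as $U_n$ from the $n$-th block to the $n$-th block. An operator $S\colon X\to Y$ is finitely strictly singular (FSS) if for every $\varepsilon>0$ there is $n\in\mathbb N$ such that $\inf_{x\in E,\|x\|=1}\|Sx\|<\varepsilon$ for every $n$-dimensional subspace $E$ of $X$. *)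

theory Defs
  imports
    "HOL-Analysis.Analysis"
    "HOL-Library.Function_Algebras"
    "Jordan_Normal_Form.Matrix"
begin

section \<open>Sequence spaces\<close>

text \<open>
  Exponents range over \<^typ>\<open>ennreal\<close>, so that \<open>\<infinity>\<close> is allowed; there \<open>1 / 0 = \<infinity>\<close> and
  \<open>1 / \<infinity> = 0\<close>.
\<close>

definition conj_exponent :: "ennreal \<Rightarrow> ennreal" where
  "conj_exponent p = 1 / (1 - 1 / p)"

lemma conj_exponent_iff:
  assumes "1 \<le> p"
  shows "1 / p + 1 / p' = 1 \<longleftrightarrow> p' = conj_exponent p"
proof -
  have le: "1 / p \<le> 1"
    using assms by (intro divide_le_posI_ennreal) (auto intro: less_le_trans[of 0 1])
  have "1 / p + 1 / p' = 1 \<longleftrightarrow> 1 / p' = 1 - 1 / p"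
  proof
    assume h: "1 / p + 1 / p' = 1"
    have "1 / p \<noteq> \<infinity>"
      using le by (auto simp: top_unique)
    then have "(1 / p + 1 / p') - 1 / p = 1 / p'"
      by simp
    then show "1 / p' = 1 - 1 / p"
      by (simp only: h)
  next
    assume "1 / p' = 1 - 1 / p"
    then show "1 / p + 1 / p' = 1"
      using le by (simp add: add_diff_inverse_ennreal)
  qed
  also have "\<dots> \<longleftrightarrow> p' = conj_exponent p"
    unfolding conj_exponent_def by (metis one_divide_one_divide_ennreal)
  finally show ?thesis .
qed

text \<open>
  \<open>lp_norm p x\<close> is only meaningful for \<open>x \<in> lp_space p\<close>.
\<close>

definition lp_space :: "ennreal \<Rightarrow> (nat \<Rightarrow> 'a::real_normed_vector) set" where
  "lp_space p =
    (if p = \<infinity> then {x. bounded (range x)}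
     else {x. summable (\<lambda>i. norm (x i) powr enn2real p)})"

definition lp_norm :: "ennreal \<Rightarrow> (nat \<Rightarrow> 'a::real_normed_vector) \<Rightarrow> real" where
  "lp_norm p x =
    (if p = \<infinity> then (SUP i. norm (x i))
     else (\<Sum>i. norm (x i) powr enn2real p) powr (1 / enn2real p))"

section \<open>Finitely strictly singular operators\<close>

definition seq_scale :: "'a::field \<Rightarrow> (nat \<Rightarrow> 'a) \<Rightarrow> nat \<Rightarrow> 'a" where
  "seq_scale c x = (\<lambda>i. c * x i)"

global_interpretation seq: vector_space "seq_scale :: 'a::field \<Rightarrow> (nat \<Rightarrow> 'a) \<Rightarrow> nat \<Rightarrow> 'a"
  by unfold_locales (auto simp: seq_scale_def algebra_simps)

text \<open>
  \<open>X\<close> and \<open>Y\<close> are spaces of sequences (with pointwise operations) normed by \<open>nX\<close> and \<open>nY\<close>.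
  Subspaces and dimensions are over the scalar type \<open>'a\<close>. Real and complex scalars are covered
  together by the sort \<open>{real_normed_field, euclidean_space}\<close>, which \<^typ>\<open>real\<close> and
  \<^typ>\<open>complex\<close> both have.
\<close>

definition bounded_operator ::
  "(nat \<Rightarrow> 'a::field) set \<Rightarrow> ((nat \<Rightarrow> 'a) \<Rightarrow> real) \<Rightarrow> (nat \<Rightarrow> 'a) set \<Rightarrow> ((nat \<Rightarrow> 'a) \<Rightarrow> real)
    \<Rightarrow> ((nat \<Rightarrow> 'a) \<Rightarrow> nat \<Rightarrow> 'a) \<Rightarrow> bool" where
  "bounded_operator X nX Y nY S \<longleftrightarrow>
    S ` X \<subseteq> Y \<and>
    (\<forall>x\<in>X. \<forall>y\<in>X. S (x + y) = S x + S y) \<and>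
    (\<forall>c. \<forall>x\<in>X. S (seq_scale c x) = seq_scale c (S x)) \<and>
    (\<exists>C. \<forall>x\<in>X. nY (S x) \<le> C * nX x)"

text \<open>
  Since \<open>n \<ge> 1\<close>, \<open>seq.dim E = n\<close> forces \<open>E\<close> to be finite-dimensional (an infinite-dimensional
  space has \<open>dim\<close> equal to \<open>0\<close>), and the infimum is over a nonempty set of nonnegative numbers.
\<close>

definition finitely_strictly_singular ::
  "(nat \<Rightarrow> 'a::field) set \<Rightarrow> ((nat \<Rightarrow> 'a) \<Rightarrow> real) \<Rightarrow> (nat \<Rightarrow> 'a) set \<Rightarrow> ((nat \<Rightarrow> 'a) \<Rightarrow> real)
    \<Rightarrow> ((nat \<Rightarrow> 'a) \<Rightarrow> nat \<Rightarrow> 'a) \<Rightarrow> bool" where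
  "finitely_strictly_singular X nX Y nY S \<longleftrightarrow>
    bounded_operator X nX Y nY S \<and>
    (\<forall>\<epsilon>>0. \<exists>n\<ge>1. \<forall>E. seq.subspace E \<and> E \<subseteq> X \<and> seq.dim E = n \<longrightarrow>
      (INF x\<in>{x\<in>E. nX x = 1}. nY (S x)) < \<epsilon>)"

section \<open>The block Hadamard operator\<close>

fun hadamard :: "nat \<Rightarrow> 'a::comm_ring_1 mat" where
  "hadamard 0 = 1\<^sub>m 1"
| "hadamard (Suc n) =
    four_block_mat (hadamard n) (hadamard n) (hadamard n) (- hadamard n)"

lemma hadamard_carrier: "hadamard n \<in> carrier_mat (2 ^ n) (2 ^ n)"
  by (induction n) auto

text \<open>
  \<open>x\<close> is cut into consecutive blocks, numbered from 1, the \<open>n\<close>-th one of length \<open>2 ^ n\<close>.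
\<close>

definition block_start :: "nat \<Rightarrow> nat" where
  "block_start n = (\<Sum>k=1..<n. 2 ^ k)"

definition block_of :: "nat \<Rightarrow> nat" where
  "block_of i = (LEAST n. i < block_start (Suc n))"

definition seq_block :: "nat \<Rightarrow> (nat \<Rightarrow> 'a) \<Rightarrow> 'a vec" where
  "seq_block n x = vec (2 ^ n) (\<lambda>k. x (block_start n + k))"

definition block_sum :: "(nat \<Rightarrow> 'a vec \<Rightarrow> 'a vec) \<Rightarrow> (nat \<Rightarrow> 'a) \<Rightarrow> nat \<Rightarrow> 'a" where
  "block_sum T x i =
    (let n = block_of i in vec_index (T n (seq_block n x)) (i - block_start n))"

lemma block_start_Suc: "n \<ge> 1 \<Longrightarrow> block_start (Suc n) = block_start n + 2 ^ n"
  by (simp add: block_start_def)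

lemma block_start_mono: "m \<le> n \<Longrightarrow> block_start m \<le> block_start n"
  by (auto simp: block_start_def intro!: sum_mono2)

lemma block_of_eq:
  assumes "n \<ge> 1" "k < 2 ^ n"
  shows "block_of (block_start n + k) = n"
  unfolding block_of_def
proof (rule Least_equality)
  show "block_start n + k < block_start (Suc n)"
    using assms by (simp add: block_start_Suc)
next
  fix m assume m: "block_start n + k < block_start (Suc m)"
  show "n \<le> m"
  proof (rule ccontr)
    assume "\<not> n \<le> m"
    then have "block_start (Suc m) \<le> block_start n"
      by (intro block_start_mono) simp
    with m show False by simp
  qed
qed

lemma seq_block_block_sum:
  assumes "n \<ge> 1" "dim_vec (T n (seq_block n x)) = 2 ^ n"
  shows "seq_block n (block_sum T x) = T n (seq_block n x)"
  using assms by (intro eq_vecI) (auto simp: seq_block_def block_sum_def block_of_eq)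

definition hadamard_op ::
  "ennreal \<Rightarrow> ennreal \<Rightarrow> nat \<Rightarrow> 'a::real_normed_field vec \<Rightarrow> 'a vec" where
  "hadamard_op p q n v =
    of_real (real (2 ^ n) powr (- enn2real (1 / min (conj_exponent p) q)))
      \<cdot>\<^sub>v (hadamard n *\<^sub>v v)"

definition block_hadamard ::
  "ennreal \<Rightarrow> ennreal \<Rightarrow> (nat \<Rightarrow> 'a::real_normed_field) \<Rightarrow> nat \<Rightarrow> 'a" where
  "block_hadamard p q = block_sum (hadamard_op p q)"

end

theory Submission
  imports Defs "Jordan_Normal_Form.Determinant"
begin

text \<open>
  For a tuple \<open>f\<^sub>1, \<dots>, f\<^sub>m\<close> of sequences let \<open>F(k)\<close> and \<open>G(l)\<close> be the Euclidean lengths of the vectors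
  \<open>(f\<^sub>i(k))\<^sub>i\<close> and \<open>((U f\<^sub>i)(l))\<^sub>i\<close>, and let \<open>W = \<Sum>\<^sub>k F(k)\<^sup>s\<close>. Call the tuple weakly bounded in \<open>\<ell>\<^sub>s\<close> if
  \<open>\<parallel>\<Sum>\<^sub>i v\<^sub>i f\<^sub>i\<parallel> \<le> |v|\<close> for all real \<open>v\<close>, where \<open>|v|\<close> is the Euclidean length; such a tuple is a contraction
  from a Hilbert space.

  Boundedness of \<open>U\<close> from \<open>\<ell>\<^sub>s\<close> to \<open>\<ell>\<^sub>q\<close> controls \<open>\<Sum>\<^sub>l G(l)\<^sup>q\<close> by a multiple of \<open>W\<close> to the power \<open>q/s\<close>. The
  whole proof rests on the fact that weakly bounded tuples do better: they satisfy
  \<open>\<Sum>\<^sub>l G(l)\<^sup>q \<le> C W\<^sup>\<kappa>\<close> with some \<open>\<kappa> < q/s\<close>; this is the predicate \<open>weak_to_strong\<close>. By Khinchine's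
  inequality the random vector \<open>x = \<Sum>\<^sub>i \<plusminus>f\<^sub>i\<close> has \<open>\<parallel>x\<parallel>\<^sup>s\<close> about \<open>W\<close> and \<open>\<parallel>U x\<parallel>\<^sup>q\<close> at most about \<open>W\<^sup>\<kappa>\<close> on
  average, so that some choice of signs makes \<open>\<parallel>U x\<parallel> / \<parallel>x\<parallel>\<close> small as soon as \<open>W\<close> is large
  (\<open>weak_to_strong_imp_small_vector\<close>).

  Tuples with large \<open>W\<close> exist in every subspace of large dimension. An Auerbach system
  (\<open>auerbach_system\<close>) gives the subspace a Euclidean norm which differs from the given norm by a factor
  polynomial in the dimension \<open>n\<close>. That leaves \<open>O(log n)\<close> dyadic scales for the ratio of the two norms, and
  by the pigeonhole principle some scale carries \<open>m\<close> orthonormal vectors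
  (\<open>large_orthonormal_family\<close>, \<open>hilbertian_system\<close>). Suitably rescaled, they are weakly bounded and have norms
  at least \<open>1/2\<close>, and then \<open>W\<close> grows at least like the square root of \<open>m\<close> (\<open>square_function_large\<close>).

  As for the choice of exponents, the blocks \<open>U\<^sub>n\<close> depend only on \<open>r = min {p', q}\<close>. If \<open>r > 2\<close> then
  \<open>\<ell>\<^sub>p \<subseteq> \<ell>\<^sub>s\<close> for the exponent \<open>s\<close> conjugate to \<open>r\<close>, and \<open>\<ell>\<^sub>r \<subseteq> \<ell>\<^sub>q\<close>, both with norm one, so that \<open>U\<close> may be
  studied as an operator from \<open>\<ell>\<^sub>s\<close> to \<open>\<ell>\<^sub>r\<close>. The improved estimate is there a form of Marcinkiewicz
  interpolation between Parseval's identity and the trivial bound from \<open>\<ell>\<^sub>1\<close> to \<open>\<ell>\<^sub>\<infinity>\<close>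
  (\<open>weak_to_strong_dual_exponents\<close>); at the \<open>\<ell>\<^sub>1\<close> end, weak boundedness and Hoelder's inequality bound the
  part of the tuple where \<open>F > t\<close> by \<open>t\<^sup>1\<^sup>-\<^sup>s W\<close> with the exponent of \<open>W\<close> lowered from \<open>1\<close> to \<open>1/r\<close>. If
  \<open>r = 2\<close> then \<open>U\<close> is an isometry of \<open>\<ell>\<^sub>2\<close>, one of \<open>p\<close> and \<open>q\<close> is \<open>2\<close> and the other is not, and the improvement
  is the uniform bound which weak boundedness puts on \<open>F\<close> or on \<open>G\<close>
  (\<open>weak_to_strong_into_l2\<close>, \<open>weak_to_strong_from_l2\<close>).
\<close>

section \<open>Moments of Rademacher sums\<close>

definition signs :: "'i set \<Rightarrow> 'i \<Rightarrow> real" where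
  "signs A i = (if i \<in> A then 1 else - 1)"

text \<open>
  A choice of signs is encoded by the set \<open>A\<close> of indices with sign \<open>+1\<close>, so that an average over all
  signs is an average over \<open>Pow I\<close>.
\<close>
definition rademacher :: "'i set \<Rightarrow> ('i \<Rightarrow> 'b::real_vector) \<Rightarrow> 'i set \<Rightarrow> 'b" where
  "rademacher I w A = (\<Sum>i\<in>I. signs A i *\<^sub>R w i)"

lemma sum_Pow_insert:
  fixes h :: "'i set \<Rightarrow> real"
  assumes "finite I" "j \<notin> I"
  shows "sum h (Pow (insert j I)) = (\<Sum>A\<in>Pow I. h (insert j A) + h A)"
proof -
  have inj: "inj_on (insert j) (Pow I)"
    using assms(2) by (intro inj_onI) (metis PowD insert_ident subsetD)
  have "sum h (Pow (insert j I)) = sum h (Pow I) + sum h (insert j ` Pow I)"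
    unfolding Pow_insert using assms by (intro sum.union_disjoint) auto
  also have "sum h (insert j ` Pow I) = (\<Sum>A\<in>Pow I. h (insert j A))"
    by (simp add: sum.reindex[OF inj])
  finally show ?thesis by (simp add: sum.distrib add.commute)
qed

lemma rademacher_insert:
  assumes "finite I" "j \<notin> I" "A \<subseteq> I"
  shows "rademacher (insert j I) w (insert j A) = rademacher I w A + w j"
    and "rademacher (insert j I) w A = rademacher I w A - w j"
proof -
  have "(\<Sum>i\<in>I. signs (insert j A) i *\<^sub>R w i) = (\<Sum>i\<in>I. signs A i *\<^sub>R w i)"
    using assms by (intro sum.cong) (auto simp: signs_def)
  then show "rademacher (insert j I) w (insert j A) = rademacher I w A + w j"
    using assms by (simp add: rademacher_def signs_def add.commute)
  show "rademacher (insert j I) w A = rademacher I w A - w j"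
    using assms by (auto simp: rademacher_def signs_def)
qed

lemma parallelogram_law:
  "(norm (x + y))\<^sup>2 + (norm (x - y))\<^sup>2 = 2 * (norm x)\<^sup>2 + 2 * (norm (y::'b::real_inner))\<^sup>2"
  by (simp add: power2_norm_eq_inner inner_add inner_diff inner_commute)

lemma rademacher_second_moment:
  fixes w :: "'i \<Rightarrow> 'b::real_inner"
  assumes "finite I"
  shows "(\<Sum>A\<in>Pow I. (norm (rademacher I w A))\<^sup>2) = 2 ^ card I * (\<Sum>i\<in>I. (norm (w i))\<^sup>2)"
  using assms
proof (induction I)
  case empty
  then show ?case by (simp add: rademacher_def)
next
  case (insert j I)
  have "(\<Sum>A\<in>Pow (insert j I). (norm (rademacher (insert j I) w A))\<^sup>2)
      = (\<Sum>A\<in>Pow I. (norm (rademacher I w A + w j))\<^sup>2 + (norm (rademacher I w A - w j))\<^sup>2)"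
    unfolding sum_Pow_insert[OF insert(1,2)]
    by (intro sum.cong refl) (use insert in \<open>simp add: rademacher_insert\<close>)
  also have "\<dots> = 2 * (\<Sum>A\<in>Pow I. (norm (rademacher I w A))\<^sup>2) + 2 * 2 ^ card I * (norm (w j))\<^sup>2"
    using insert(1) by (simp add: parallelogram_law sum.distrib sum_distrib_left card_Pow)
  finally show ?case using insert by (simp add: algebra_simps)
qed

text \<open>
  The constant \<open>1\<close> in the exponent, instead of the optimal \<open>1/2\<close>, makes the elementary bounds on the two
  sides of \<open>\<bar>x\<bar> = 1\<close> sufficient.
\<close>
lemma exp_add_exp_minus_le: "exp x + exp (- x) \<le> 2 * exp (x\<^sup>2)" for x :: real
proof -
  have *: "exp x + exp (- x) \<le> 2 * exp (x\<^sup>2)" if "0 \<le> x" for x :: real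
  proof (cases "x \<le> 1")
    case True
    have "exp (- x) \<le> 1 / (1 + x)"
      using exp_ge_add_one_self[of x] that by (simp add: exp_minus field_simps)
    also have "\<dots> \<le> 1 - x + x\<^sup>2"
    proof -
      have "(1 - x + x\<^sup>2) * (1 + x) = 1 + x ^ 3"
        by (simp add: algebra_simps power2_eq_square power3_eq_cube)
      then show ?thesis using that by (simp add: divide_le_eq)
    qed
    finally have "exp x + exp (- x) \<le> 2 * (1 + x\<^sup>2)"
      using exp_bound[OF that True] by simp
    also have "\<dots> \<le> 2 * exp (x\<^sup>2)"
      by (intro mult_left_mono exp_ge_add_one_self) auto
    finally show ?thesis .
  next
    case False
    then have "x * 1 \<le> x\<^sup>2" unfolding power2_eq_square by (intro mult_left_mono) auto
    then have "exp x \<le> exp (x\<^sup>2)" by simp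
    moreover have "exp (- x) \<le> exp x" using False by simp
    ultimately show ?thesis by linarith
  qed
  from *[of x] *[of "- x"] show ?thesis by (cases "0 \<le> x") (auto simp: add.commute)
qed

lemma rademacher_exponential_moment:
  fixes a :: "'i \<Rightarrow> real"
  assumes "finite I"
  shows "(\<Sum>A\<in>Pow I. exp (rademacher I a A)) \<le> 2 ^ card I * exp (\<Sum>i\<in>I. (a i)\<^sup>2)"
  using assms
proof (induction I)
  case empty
  then show ?case by (simp add: rademacher_def)
next
  case (insert j I)
  have "(\<Sum>A\<in>Pow (insert j I). exp (rademacher (insert j I) a A))
      = (\<Sum>A\<in>Pow I. exp (rademacher I a A) * (exp (a j) + exp (- a j)))"
    unfolding sum_Pow_insert[OF insert(1,2)]
    by (intro sum.cong refl) (use insert in \<open>simp add: rademacher_insert exp_add exp_diff exp_minus field_simps\<close>)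
  also have "\<dots> \<le> (2 ^ card I * exp (\<Sum>i\<in>I. (a i)\<^sup>2)) * (2 * exp ((a j)\<^sup>2))"
    unfolding sum_distrib_right[symmetric]
    by (intro mult_mono insert.IH exp_add_exp_minus_le) (auto intro: add_nonneg_nonneg)
  finally show ?case using insert by (simp add: exp_add algebra_simps)
qed

lemma powr_le_exp: "u powr q \<le> q powr q * exp u" if "0 \<le> u" "0 < q" for u q :: real
proof -
  have "u \<le> q * exp (u / q)"
    using exp_ge_add_one_self[of "u / q"] that by (simp add: field_simps)
  then have "u powr q \<le> (q * exp (u / q)) powr q"
    using that by (intro powr_mono2) auto
  also have "\<dots> = q powr q * exp u"
    using that by (simp add: powr_mult powr_def[of "exp _"])
  finally show ?thesis .
qed

lemma rademacher_scaleR: "rademacher I (\<lambda>i. c *\<^sub>R w i) A = c *\<^sub>R rademacher I w A"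
  by (simp add: rademacher_def scaleR_sum_right mult.commute)

text \<open>
  After normalization to \<open>L2_set a I = 1\<close>, exponential moments of the sum and of its negative are bounded by a
  constant, and an exponential dominates every power.
\<close>
lemma khinchine_real:
  fixes a :: "'i \<Rightarrow> real"
  assumes "finite I" "0 < q"
  shows "(\<Sum>A\<in>Pow I. \<bar>rademacher I a A\<bar> powr q)
    \<le> 2 ^ card I * (2 * exp 1 * q powr q * L2_set a I powr q)"
proof (cases "L2_set a I = 0")
  case True
  then have "rademacher I a A = 0" for A
    using assms by (simp add: L2_set_eq_0_iff rademacher_def)
  then show ?thesis using assms by simp
next
  case False
  define F where "F = L2_set a I"
  have F: "F > 0" using False L2_set_nonneg[of a I] unfolding F_def by linarith
  define b where "b = (\<lambda>i. (1 / F) *\<^sub>R a i)"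
  have sb: "(\<Sum>i\<in>I. (b i)\<^sup>2) = 1"
  proof -
    have "(\<Sum>i\<in>I. (b i)\<^sup>2) = (\<Sum>i\<in>I. (a i)\<^sup>2) / F\<^sup>2"
      unfolding b_def by (simp add: power_divide sum_divide_distrib)
    also have "(\<Sum>i\<in>I. (a i)\<^sup>2) = F\<^sup>2"
      unfolding F_def L2_set_def by (simp add: sum_nonneg)
    finally show ?thesis using F by simp
  qed
  have Rb: "rademacher I b A = rademacher I a A / F" for A
    unfolding b_def rademacher_scaleR by simp
  have Rm: "rademacher I (\<lambda>i. - b i) A = - rademacher I b A" for A
    using rademacher_scaleR[of I "- 1" b A] by simp
  have e1: "(\<Sum>A\<in>Pow I. exp (rademacher I b A)) \<le> 2 ^ card I * exp 1"
    using rademacher_exponential_moment[OF assms(1), of b] sb by simp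
  have e2: "(\<Sum>A\<in>Pow I. exp (- rademacher I b A)) \<le> 2 ^ card I * exp 1"
    using rademacher_exponential_moment[OF assms(1), of "\<lambda>i. - b i"] sb Rm by simp
  have "\<bar>rademacher I a A\<bar> powr q
      \<le> F powr q * (q powr q * (exp (rademacher I b A) + exp (- rademacher I b A)))" for A
  proof -
    have "\<bar>rademacher I a A\<bar> powr q = F powr q * \<bar>rademacher I b A\<bar> powr q"
      using F unfolding Rb by (simp add: powr_divide)
    also have "\<bar>rademacher I b A\<bar> powr q \<le> q powr q * exp \<bar>rademacher I b A\<bar>"
      by (rule powr_le_exp) (use assms in auto)
    also have "exp \<bar>rademacher I b A\<bar> \<le> exp (rademacher I b A) + exp (- rademacher I b A)"
      by (cases "0 \<le> rademacher I b A") auto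
    finally show ?thesis by (simp add: mult_left_mono)
  qed
  then have "(\<Sum>A\<in>Pow I. \<bar>rademacher I a A\<bar> powr q)
      \<le> (\<Sum>A\<in>Pow I. F powr q * (q powr q * (exp (rademacher I b A) + exp (- rademacher I b A))))"
    by (rule sum_mono)
  also have "\<dots> = F powr q * (q powr q *
      ((\<Sum>A\<in>Pow I. exp (rademacher I b A)) + (\<Sum>A\<in>Pow I. exp (- rademacher I b A))))"
    by (simp only: sum_distrib_left[symmetric] sum.distrib)
  also have "\<dots> \<le> F powr q * (q powr q * (2 ^ card I * exp 1 + 2 ^ card I * exp 1))"
    by (intro mult_left_mono add_mono e1 e2) auto
  finally show ?thesis by (simp add: F_def algebra_simps)
qed

lemma powr_sum_le:
  fixes c :: "'i \<Rightarrow> real"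
  assumes "finite I" "0 < q" "\<And>i. i \<in> I \<Longrightarrow> 0 \<le> c i"
  shows "(\<Sum>i\<in>I. c i) powr q \<le> real (card I) powr q * (\<Sum>i\<in>I. c i powr q)"
proof (cases "I = {}")
  case False
  define M where "M = Max (c ` I)"
  have "M \<in> c ` I" unfolding M_def using False assms by (intro Max_in) auto
  then obtain j where j: "j \<in> I" "M = c j" by auto
  have "(\<Sum>i\<in>I. c i) \<le> real (card I) * M"
    using assms unfolding M_def by (intro sum_bounded_above) auto
  then have "(\<Sum>i\<in>I. c i) powr q \<le> (real (card I) * M) powr q"
    using assms by (intro powr_mono2 sum_nonneg) auto
  also have "\<dots> = real (card I) powr q * c j powr q"
    using j assms by (simp add: powr_mult)
  also have "\<dots> \<le> real (card I) powr q * (\<Sum>i\<in>I. c i powr q)"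
    using j assms by (intro mult_left_mono member_le_sum) auto
  finally show ?thesis .
qed (use assms in auto)

lemma rademacher_inner: "inner (rademacher I w A) b = rademacher I (\<lambda>i. inner (w i) b) A"
  by (simp add: rademacher_def inner_sum_left)

definition khinchine_const :: "'b::euclidean_space itself \<Rightarrow> real \<Rightarrow> real" where
  "khinchine_const _ q = real DIM('b) powr (q + 1) * (2 * exp 1 * q powr q)"

lemma khinchine_const_pos: "0 < q \<Longrightarrow> 0 < khinchine_const TYPE('b::euclidean_space) q"
  by (simp add: khinchine_const_def)

text \<open>
  Khinchine's inequality for vectors: it holds in each coordinate, and the loss of a power of the dimension
  is harmless because the bound remains independent of the number of summands.
\<close>
lemma khinchine_upper:
  fixes w :: "'i \<Rightarrow> 'b::euclidean_space"
  assumes "finite I" "0 < q"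
  shows "(\<Sum>A\<in>Pow I. norm (rademacher I w A) powr q)
    \<le> 2 ^ card I * (khinchine_const TYPE('b) q * L2_set (\<lambda>i. norm (w i)) I powr q)"
proof -
  let ?R = "\<lambda>b A. rademacher I (\<lambda>i. inner (w i) b) A"
  let ?d = "real DIM('b)"
  have "norm (rademacher I w A) powr q \<le> ?d powr q * (\<Sum>b\<in>Basis. \<bar>?R b A\<bar> powr q)" for A
  proof -
    have "norm (rademacher I w A) powr q \<le> (\<Sum>b\<in>Basis. \<bar>?R b A\<bar>) powr q"
      using norm_le_l1[of "rademacher I w A"] assms(2)
      by (intro powr_mono2) (auto simp: rademacher_inner)
    also have "\<dots> \<le> ?d powr q * (\<Sum>b\<in>Basis. \<bar>?R b A\<bar> powr q)"
      by (rule powr_sum_le) (use assms in auto)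
    finally show ?thesis .
  qed
  then have "(\<Sum>A\<in>Pow I. norm (rademacher I w A) powr q)
      \<le> (\<Sum>A\<in>Pow I. ?d powr q * (\<Sum>b\<in>Basis. \<bar>?R b A\<bar> powr q))"
    by (rule sum_mono)
  also have "\<dots> = ?d powr q * (\<Sum>b\<in>Basis. \<Sum>A\<in>Pow I. \<bar>?R b A\<bar> powr q)"
    by (subst sum.swap) (simp add: sum_distrib_left)
  also have "\<dots> \<le> ?d powr q * (\<Sum>b\<in>(Basis::'b set). 2 ^ card I *
      (2 * exp 1 * q powr q * L2_set (\<lambda>i. norm (w i)) I powr q))"
  proof (intro mult_left_mono sum_mono)
    fix b :: 'b assume b: "b \<in> Basis"
    have "L2_set (\<lambda>i. inner (w i) b) I = L2_set (\<lambda>i. \<bar>inner (w i) b\<bar>) I"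
      by (simp add: L2_set_def)
    also have "\<dots> \<le> L2_set (\<lambda>i. norm (w i)) I"
      by (rule L2_set_mono) (auto intro: Basis_le_norm[OF b])
    finally have "L2_set (\<lambda>i. inner (w i) b) I powr q \<le> L2_set (\<lambda>i. norm (w i)) I powr q"
      using assms(2) by (intro powr_mono2) auto
    then have "2 ^ card I * (2 * exp 1 * q powr q * L2_set (\<lambda>i. inner (w i) b) I powr q)
        \<le> 2 ^ card I * (2 * exp 1 * q powr q * L2_set (\<lambda>i. norm (w i)) I powr q)"
      by (intro mult_left_mono) auto
    with khinchine_real[OF assms, of "\<lambda>i. inner (w i) b"]
    show "(\<Sum>A\<in>Pow I. \<bar>?R b A\<bar> powr q)
      \<le> 2 ^ card I * (2 * exp 1 * q powr q * L2_set (\<lambda>i. norm (w i)) I powr q)"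
      by linarith
  qed auto
  also have "\<dots> = 2 ^ card I * (khinchine_const TYPE('b) q * L2_set (\<lambda>i. norm (w i)) I powr q)"
    by (simp add: khinchine_const_def powr_add algebra_simps)
  finally show ?thesis .
qed

text \<open>
  The second moment is known exactly and the fourth is at most a constant times its square. Where the
  sum exceeds \<open>M\<close> times its standard deviation, the fourth moment shows that little of the second moment is
  lost; elsewhere the second power is dominated by the \<open>s\<close>-th power.
\<close>
lemma khinchine_lower:
  fixes w :: "'i \<Rightarrow> 'b::euclidean_space"
  assumes I: "finite I" and s: "1 \<le> s" "s \<le> 2"
  defines "M \<equiv> 2 + khinchine_const TYPE('b) 4"
  shows "2 ^ card I * L2_set (\<lambda>i. norm (w i)) I powr s
    \<le> 2 * M * (\<Sum>A\<in>Pow I. norm (rademacher I w A) powr s)"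
proof (cases "L2_set (\<lambda>i. norm (w i)) I = 0")
  case True
  have "0 \<le> M" unfolding M_def using khinchine_const_pos[of 4, where ?'b='b] by simp
  then show ?thesis using True s by (auto intro!: mult_nonneg_nonneg sum_nonneg)
next
  case False
  define F where "F = L2_set (\<lambda>i. norm (w i)) I"
  have F: "F > 0" using False L2_set_nonneg[of "\<lambda>i. norm (w i)" I] unfolding F_def by linarith
  define C where "C = khinchine_const TYPE('b) 4"
  have C: "C > 0" unfolding C_def by (rule khinchine_const_pos) simp
  have M: "M \<ge> 2" "C \<le> M" unfolding M_def C_def[symmetric] using C by auto
  define R where "R = (\<lambda>A. norm (rademacher I w A))"
  have R0: "R A \<ge> 0" for A unfolding R_def by simp
  have FF: "F\<^sup>2 = (\<Sum>i\<in>I. (norm (w i))\<^sup>2)"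
    unfolding F_def L2_set_def by (simp add: sum_nonneg)
  have pw: "(R A)\<^sup>2 \<le> M * F powr (2 - s) * R A powr s + R A ^ 4 / (M\<^sup>2 * F\<^sup>2)" for A
  proof (cases "R A \<le> M * F")
    case True
    have "(R A)\<^sup>2 = R A powr (2 - s) * R A powr s"
      by (cases "R A = 0") (use R0[of A] in \<open>auto simp: powr_add[symmetric] less_le\<close>)
    also have "R A powr (2 - s) \<le> (M * F) powr (2 - s)"
      using True s R0 by (intro powr_mono2) auto
    also have "\<dots> = M powr (2 - s) * F powr (2 - s)" using M F by (simp add: powr_mult)
    also have "M powr (2 - s) \<le> M powr 1" using s M by (intro powr_mono) auto
    finally have "(R A)\<^sup>2 \<le> M * F powr (2 - s) * R A powr s"
      using M by (simp add: mult_right_mono)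
    moreover have "R A ^ 4 / (M\<^sup>2 * F\<^sup>2) \<ge> 0" by simp
    ultimately show ?thesis by linarith
  next
    case False
    have "(M * F)\<^sup>2 \<le> (R A)\<^sup>2" using False M F by (intro power_mono) auto
    then have "(R A)\<^sup>2 * (M\<^sup>2 * F\<^sup>2) \<le> (R A)\<^sup>2 * (R A)\<^sup>2"
      by (intro mult_left_mono) (auto simp: power_mult_distrib)
    also have "\<dots> = R A ^ 4" by (simp flip: power_add)
    finally have "(R A)\<^sup>2 \<le> R A ^ 4 / (M\<^sup>2 * F\<^sup>2)"
      using M F by (simp add: le_divide_eq)
    moreover have "M * F powr (2 - s) * R A powr s \<ge> 0" using M by simp
    ultimately show ?thesis by linarith
  qed
  have r4: "R A powr 4 = R A ^ 4" for A
    using R0[of A] by (cases "R A = 0") (auto simp: less_le)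
  have "2 ^ card I * F\<^sup>2 = (\<Sum>A\<in>Pow I. (R A)\<^sup>2)"
    unfolding R_def FF by (rule rademacher_second_moment[OF I, symmetric])
  also have "\<dots> \<le> (\<Sum>A\<in>Pow I. M * F powr (2 - s) * R A powr s + R A ^ 4 / (M\<^sup>2 * F\<^sup>2))"
    by (intro sum_mono pw)
  also have "\<dots> = M * F powr (2 - s) * (\<Sum>A\<in>Pow I. R A powr s)
      + (\<Sum>A\<in>Pow I. R A powr 4) / (M\<^sup>2 * F\<^sup>2)"
    by (simp add: sum.distrib sum_distrib_left sum_divide_distrib r4)
  also have "(\<Sum>A\<in>Pow I. R A powr 4) \<le> 2 ^ card I * (C * F powr 4)"
    unfolding R_def F_def C_def by (rule khinchine_upper) (use I in auto)
  also have "F powr 4 = F ^ 4" using F by simp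
  finally have "2 ^ card I * F\<^sup>2 \<le> M * F powr (2 - s) * (\<Sum>A\<in>Pow I. R A powr s)
      + 2 ^ card I * (C * F ^ 4) / (M\<^sup>2 * F\<^sup>2)"
    using M F by (simp add: divide_right_mono)
  moreover have "2 ^ card I * (C * F ^ 4) / (M\<^sup>2 * F\<^sup>2) \<le> 2 ^ card I * F\<^sup>2 / 2"
  proof -
    have "C * 2 \<le> M * M" using M C by (intro mult_mono) auto
    then have CM: "C / M\<^sup>2 \<le> 1 / 2" using M by (simp add: field_simps power2_eq_square)
    have "2 ^ card I * (C * F ^ 4) / (M\<^sup>2 * F\<^sup>2) = (2 ^ card I * F\<^sup>2) * (C / M\<^sup>2)"
      using F by (simp add: field_simps power2_eq_square power4_eq_xxxx)
    also have "\<dots> \<le> (2 ^ card I * F\<^sup>2) * (1 / 2)" by (intro mult_left_mono CM) auto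
    finally show ?thesis by simp
  qed
  ultimately have "2 ^ card I * F\<^sup>2 \<le> 2 * (M * F powr (2 - s) * (\<Sum>A\<in>Pow I. R A powr s))"
    by linarith
  moreover have "F\<^sup>2 = F powr (2 - s) * F powr s"
    using F by (simp add: powr_add[symmetric])
  ultimately have "F powr (2 - s) * (2 ^ card I * F powr s)
      \<le> F powr (2 - s) * (2 * M * (\<Sum>A\<in>Pow I. R A powr s))"
    by (simp add: algebra_simps)
  then show ?thesis using F by (simp add: F_def R_def)
qed

text \<open>
  The coefficients are real while the \<open>w i\<close> are vectors, so duality is applied to each coordinate \<open>b\<close>
  separately, with the coefficients \<open>v i = inner (w i) b\<close>.
\<close>
lemma L2_set_le_of_dual_bound:
  fixes w :: "'i \<Rightarrow> 'b::euclidean_space"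
  assumes I: "finite I" and K0: "0 \<le> K"
    and K: "\<And>v. norm (\<Sum>i\<in>I. v i *\<^sub>R w i) \<le> K * L2_set v I"
  shows "L2_set (\<lambda>i. norm (w i)) I \<le> real DIM('b) * K"
proof -
  have c: "L2_set (\<lambda>i. inner (w i) b) I \<le> K" if b: "b \<in> Basis" for b
  proof (cases "L2_set (\<lambda>i. inner (w i) b) I = 0")
    case False
    let ?v = "\<lambda>i. inner (w i) b"
    have "(L2_set ?v I)\<^sup>2 = (\<Sum>i\<in>I. (?v i)\<^sup>2)"
      unfolding L2_set_def by (simp add: sum_nonneg)
    also have "\<dots> = inner (\<Sum>i\<in>I. ?v i *\<^sub>R w i) b"
      by (simp add: inner_sum_left power2_eq_square)
    also have "\<dots> \<le> norm (\<Sum>i\<in>I. ?v i *\<^sub>R w i)"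
      using Basis_le_norm[OF b] abs_le_D1 by blast
    also have "\<dots> \<le> K * L2_set ?v I" by (rule K)
    finally show ?thesis
      using False L2_set_nonneg[of ?v I] by (simp add: power2_eq_square)
  qed (use K0 in simp)
  have "(L2_set (\<lambda>i. norm (w i)) I)\<^sup>2 = (\<Sum>i\<in>I. (norm (w i))\<^sup>2)"
    unfolding L2_set_def by (simp add: sum_nonneg)
  also have "\<dots> = (\<Sum>i\<in>I. \<Sum>b\<in>Basis. (inner (w i) b)\<^sup>2)"
    unfolding power2_norm_eq_inner euclidean_inner[of "w _" "w _"] by (simp only: power2_eq_square)
  also have "\<dots> = (\<Sum>b\<in>Basis. (L2_set (\<lambda>i. inner (w i) b) I)\<^sup>2)"
    unfolding L2_set_def by (subst sum.swap) (simp add: sum_nonneg)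
  also have "\<dots> \<le> (\<Sum>b\<in>(Basis :: 'b set). K\<^sup>2)"
    by (intro sum_mono power_mono c) auto
  also have "\<dots> = real DIM('b) * K\<^sup>2" by simp
  also have "\<dots> \<le> (real DIM('b) * real DIM('b)) * K\<^sup>2"
    using mult_left_mono[of 1 "real DIM('b)" "real DIM('b)"]
    by (intro mult_right_mono) (auto simp: Suc_le_eq)
  also have "\<dots> = (real DIM('b) * K)\<^sup>2"
    unfolding power2_eq_square by (simp only: mult.assoc mult.left_commute)
  finally show ?thesis
    by (rule power2_le_imp_le) (use K0 in simp)
qed

section \<open>Power sums of sequences\<close>

text \<open>
  The \<open>s\<close>-th power of the norm of \<open>\<ell>\<^sub>s\<close> adds up over blocks and over index sets, and for finite sums of sequences
  the crude inequality \<open>psum_sum\<close> can replace the triangle inequality, since factors polynomial in the number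
  of summands do no harm.
\<close>
definition psum :: "real \<Rightarrow> (nat \<Rightarrow> 'b::real_normed_vector) \<Rightarrow> real" where
  "psum s x = (\<Sum>k. norm (x k) powr s)"

definition psummable :: "real \<Rightarrow> (nat \<Rightarrow> 'b::real_normed_vector) \<Rightarrow> bool" where
  "psummable s x \<longleftrightarrow> summable (\<lambda>k. norm (x k) powr s)"

lemma psum_nonneg: "psummable s x \<Longrightarrow> 0 \<le> psum s x"
  unfolding psum_def psummable_def by (rule suminf_nonneg) auto

lemma psum_scale:
  "psummable s x \<Longrightarrow> psummable s (\<lambda>k. c *\<^sub>R x k)"
  "psummable s x \<Longrightarrow> psum s (\<lambda>k. c *\<^sub>R x k) = \<bar>c\<bar> powr s * psum s x"
  unfolding psum_def psummable_def by (auto simp: powr_mult suminf_mult summable_mult)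

lemma psum_sum:
  assumes "finite I" "0 < s" "\<And>i. i \<in> I \<Longrightarrow> psummable s (y i)"
  shows "psummable s (\<lambda>k. \<Sum>i\<in>I. y i k)"
    and "psum s (\<lambda>k. \<Sum>i\<in>I. y i k) \<le> real (card I) powr s * (\<Sum>i\<in>I. psum s (y i))"
proof -
  have le: "norm (\<Sum>i\<in>I. y i k) powr s \<le> real (card I) powr s * (\<Sum>i\<in>I. norm (y i k) powr s)" for k
  proof -
    have "norm (\<Sum>i\<in>I. y i k) powr s \<le> (\<Sum>i\<in>I. norm (y i k)) powr s"
      using assms by (intro powr_mono2 norm_sum) auto
    also have "\<dots> \<le> real (card I) powr s * (\<Sum>i\<in>I. norm (y i k) powr s)"
      by (rule powr_sum_le) (use assms in auto)
    finally show ?thesis .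
  qed
  have sm: "summable (\<lambda>k. real (card I) powr s * (\<Sum>i\<in>I. norm (y i k) powr s))"
    using assms(3) unfolding psummable_def by (intro summable_mult summable_sum)
  show 1: "psummable s (\<lambda>k. \<Sum>i\<in>I. y i k)"
    unfolding psummable_def by (rule summable_comparison_test'[OF sm]) (use le in auto)
  have "psum s (\<lambda>k. \<Sum>i\<in>I. y i k) \<le> (\<Sum>k. real (card I) powr s * (\<Sum>i\<in>I. norm (y i k) powr s))"
    unfolding psum_def by (rule suminf_le[OF le 1[unfolded psummable_def] sm])
  also have "\<dots> = real (card I) powr s * (\<Sum>i\<in>I. psum s (y i))"
    using assms(3) unfolding psum_def psummable_def
    by (subst suminf_mult) (auto intro: summable_sum simp: suminf_sum)
  finally show "psum s (\<lambda>k. \<Sum>i\<in>I. y i k) \<le> real (card I) powr s * (\<Sum>i\<in>I. psum s (y i))" .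
qed

lemma psum_eq_0:
  assumes "psummable s x" "psum s x = 0" shows "x k = 0"
proof -
  have "\<forall>k. norm (x k) powr s = 0"
    using assms suminf_eq_zero_iff[of "\<lambda>k. norm (x k) powr s"]
    unfolding psum_def psummable_def by simp
  then show ?thesis by simp
qed

lemma norm_powr_le_psum: "psummable s x \<Longrightarrow> norm (x k) powr s \<le> psum s x"
  unfolding psum_def psummable_def
  using sum_le_suminf[of "\<lambda>k. norm (x k) powr s" "{k}"] by auto

section \<open>Auerbach systems\<close>

text \<open>
  Linearly independent sequences are separated by finitely many coordinates. If \<open>\<kappa>\<close> works for the first \<open>m\<close>
  sequences, expand the determinant of size \<open>m + 1\<close> along its last row: as a function of the last
  coordinate it is a linear combination of the sequences, with a coefficient that is a nonzero minor.
\<close>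
lemma nonzero_minor:
  fixes e :: "nat \<Rightarrow> nat \<Rightarrow> 'a::field"
  assumes indep: "\<forall>a. (\<forall>k. (\<Sum>c<n. a c * e c k) = 0) \<longrightarrow> (\<forall>c<n. a c = 0)"
    and "m \<le> n"
  shows "\<exists>\<kappa>. Determinant.det (mat m m (\<lambda>(r, c). e c (\<kappa> r))) \<noteq> 0"
  using \<open>m \<le> n\<close>
proof (induction m)
  case 0
  show ?case by (simp add: det_dim_zero)
next
  case (Suc m)
  then obtain \<kappa> where \<kappa>: "Determinant.det (mat m m (\<lambda>(r, c). e c (\<kappa> r))) \<noteq> 0" by auto
  define A where "A = (\<lambda>k. mat (Suc m) (Suc m) (\<lambda>(r, c). e c ((\<kappa>(m := k)) r)))"
  have A: "A k \<in> carrier_mat (Suc m) (Suc m)" for k by (simp add: A_def)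
  define a where "a = (\<lambda>c. if c < Suc m then cofactor (A 0) m c else 0)"
  have del: "mat_delete (A k) m c = mat_delete (A 0) m c" if "c < Suc m" for k c
    by (rule eq_matI) (auto simp: mat_delete_def A_def)
  have row: "A k $$ (m, c) = e c k" if "c < Suc m" for k c
    using that by (simp add: A_def)
  have cof: "cofactor (A k) m c = cofactor (A 0) m c" if "c < Suc m" for k c
    by (simp only: cofactor_def del[OF that, of k])
  have exp: "Determinant.det (A k) = (\<Sum>c<n. a c * e c k)" for k
  proof -
    have "Determinant.det (A k) = (\<Sum>c<Suc m. A k $$ (m, c) * cofactor (A k) m c)"
      by (rule laplace_expansion_row[OF A]) simp
    also have "\<dots> = (\<Sum>c<Suc m. a c * e c k)"
      by (intro sum.cong refl) (simp add: a_def row cof[of _ k])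
    also have "\<dots> = (\<Sum>c<n. a c * e c k)"
      using Suc.prems by (intro sum.mono_neutral_left) (auto simp: a_def)
    finally show ?thesis .
  qed
  have "mat_delete (A 0) m m = mat m m (\<lambda>(r, c). e c (\<kappa> r))"
    by (rule eq_matI) (auto simp: mat_delete_def A_def)
  then have "a m \<noteq> 0" using \<kappa> by (simp add: a_def cofactor_def)
  then obtain k where "(\<Sum>c<n. a c * e c k) \<noteq> 0"
    using indep Suc.prems by (metis Suc_le_lessD)
  then show ?case using exp[of k] unfolding A_def by (intro exI[of _ "\<kappa>(m := k)"]) simp
qed

lemma norm_det_le:
  fixes A :: "'a::real_normed_field mat"
  assumes A: "A \<in> carrier_mat n n" and 1: "\<And>i j. i < n \<Longrightarrow> j < n \<Longrightarrow> norm (A $$ (i, j)) \<le> 1"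
  shows "norm (Determinant.det A) \<le> real (card {p. p permutes {0..<n}})"
proof -
  have "norm (Determinant.det A) \<le> (\<Sum>p | p permutes {0..<n}. 1)"
    unfolding Determinant.det_def'[OF A]
  proof (rule sum_norm_le)
    fix p assume p: "p \<in> {p. p permutes {0..<n}}"
    have "norm (A $$ (i, p i)) \<le> 1" if "i < n" for i
      using 1[OF that, of "p i"] p that permutes_in_image[of p "{0..<n}" i] by simp
    then have "(\<Prod>i = 0..<n. norm (A $$ (i, p i))) \<le> 1"
      by (intro prod_le_1) auto
    then show "norm (signof p * (\<Prod>i = 0..<n. A $$ (i, p i))) \<le> 1"
      by (simp add: norm_mult sign_def prod_norm[symmetric])
  qed
  then show ?thesis by simp
qed

lemma sum_fun_apply: "(\<Sum>i\<in>I. f i) k = (\<Sum>i\<in>I. f i k)" for f :: "'i \<Rightarrow> nat \<Rightarrow> 'a::comm_monoid_add"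
  by (induction I rule: infinite_finite_induct) auto

lemma seq_subspace_sum:
  assumes "seq.subspace E" "\<And>i. i \<in> I \<Longrightarrow> x i \<in> E"
  shows "(\<lambda>k. \<Sum>i\<in>I. a i * x i k) \<in> E"
proof -
  have "(\<Sum>i\<in>I. seq_scale (a i) (x i)) \<in> E"
    by (intro seq.subspace_sum[OF assms(1)] seq.subspace_scale[OF assms(1)] assms(2))
  also have "(\<Sum>i\<in>I. seq_scale (a i) (x i)) = (\<lambda>k. \<Sum>i\<in>I. a i * x i k)"
    by (rule ext) (simp add: sum_fun_apply seq_scale_def)
  finally show ?thesis .
qed

lemma seq_basis_family:
  fixes E :: "(nat \<Rightarrow> 'a::field) set"
  assumes "seq.subspace E" "seq.dim E = n" "1 \<le> n"
  obtains e :: "nat \<Rightarrow> nat \<Rightarrow> 'a" where "\<forall>i<n. e i \<in> E"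
    "\<forall>a. (\<forall>k. (\<Sum>c<n. a c * e c k) = 0) \<longrightarrow> (\<forall>c<n. a c = 0)"
proof -
  obtain B where B: "B \<subseteq> E" "seq.independent B" "card B = n"
    using seq.basis_exists[of E] assms by metis
  have "finite B" using B(3) assms(3) by (intro card_ge_0_finite) simp
  then obtain e where e: "bij_betw e {0..<n} B"
    using ex_bij_betw_nat_finite B(3) by blast
  show ?thesis
  proof
    show "\<forall>i<n. e i \<in> E"
      using e B(1) by (auto simp: bij_betw_def)
    show "\<forall>a. (\<forall>k. (\<Sum>c<n. a c * e c k) = 0) \<longrightarrow> (\<forall>c<n. a c = 0)"
    proof (rule allI, rule impI)
      fix a :: "nat \<Rightarrow> 'a" assume a: "\<forall>k. (\<Sum>c<n. a c * e c k) = 0"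
      define u where "u = (\<lambda>b. a (the_inv_into {0..<n} e b))"
      have ue: "u (e c) = a c" if "c < n" for c
        unfolding u_def using e that by (subst the_inv_into_f_f) (auto simp: bij_betw_def)
      have "(\<Sum>b\<in>B. seq_scale (u b) b) = (\<Sum>c\<in>{0..<n}. seq_scale (u (e c)) (e c))"
        using sum.reindex_bij_betw[OF e, of "\<lambda>b. seq_scale (u b) b"] by simp
      also have "\<dots> = 0"
      proof
        fix k
        have "(\<Sum>c\<in>{0..<n}. seq_scale (u (e c)) (e c)) k = (\<Sum>c\<in>{0..<n}. a c * e c k)"
          by (simp add: sum_fun_apply seq_scale_def ue)
        then show "(\<Sum>c\<in>{0..<n}. seq_scale (u (e c)) (e c)) k = 0 k"
          using a by (simp add: atLeast0LessThan)
      qed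
      finally have "u b = 0" if "b \<in> B" for b
        using seq.independentD[OF B(2) \<open>finite B\<close> subset_refl] that by blast
      then show "\<forall>c<n. a c = 0"
        using ue e by (metis atLeastLessThan_iff bij_betwE le0)
    qed
  qed
qed

text \<open>
  Among the systems in the unit ball of \<open>E\<close> take one whose determinant in suitable coordinates is at least
  half of the supremum. By Cramer's rule, replacing \<open>x j\<close> by a vector \<open>y = \<Sum>\<^sub>i a i * x i\<close> multiplies the
  determinant by \<open>a j\<close>, and for \<open>y\<close> in the unit ball this factor is at most \<open>2\<close>. Taking a near-maximum
  makes a compactness argument superfluous.
\<close>
lemma auerbach_system:
  fixes E :: "(nat \<Rightarrow> 'a::real_normed_field) set"
  assumes E: "seq.subspace E" "seq.dim E = n" "1 \<le> n" and s: "1 \<le> s"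
    and ls: "\<And>x. x \<in> E \<Longrightarrow> psummable s x"
  obtains x :: "nat \<Rightarrow> nat \<Rightarrow> 'a" where "\<forall>i<n. x i \<in> E \<and> psum s (x i) \<le> 1"
    "\<forall>a. \<forall>j<n. norm (a j) \<le> 2 * psum s (\<lambda>k. \<Sum>i<n. a i * x i k) powr (1 / s)"
proof -
  obtain e where e: "\<forall>i<n. e i \<in> E"
    and ind: "\<forall>a. (\<forall>k. (\<Sum>c<n. a c * e c k) = 0) \<longrightarrow> (\<forall>c<n. a c = 0)"
    by (rule seq_basis_family[OF E])
  have eE: "e i \<in> E" if "i < n" for i using e that by blast
  obtain \<kappa> where \<kappa>: "Determinant.det (mat n n (\<lambda>(r, c). e c (\<kappa> r))) \<noteq> 0"
    using nonzero_minor[OF ind order_refl] by blast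
  define M where "M = (\<lambda>x::nat \<Rightarrow> nat \<Rightarrow> 'a. mat n n (\<lambda>(r, c). x c (\<kappa> r)))"
  have Mc: "M x \<in> carrier_mat n n" for x by (simp add: M_def)
  define D where "D = (\<lambda>x. norm (Determinant.det (M x)))"
  define F where "F = {x. \<forall>i<n. x i \<in> E \<and> psum s (x i) \<le> 1}"
  have bdd: "bdd_above (D ` F)"
  proof (rule bdd_aboveI2)
    fix x assume x: "x \<in> F"
    show "D x \<le> real (card {p. p permutes {0..<n}})"
      unfolding D_def
    proof (rule norm_det_le[OF Mc])
      fix i j assume ij: "i < n" "j < n"
      have "norm (x j (\<kappa> i)) powr s \<le> 1"
        using norm_powr_le_psum[OF ls, of "x j" "\<kappa> i"] x ij unfolding F_def by force
      then have "norm (x j (\<kappa> i)) \<le> 1"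
        using s powr_less_mono2[of s 1 "norm (x j (\<kappa> i))"] by (force simp: not_le[symmetric])
      then show "norm (M x $$ (i, j)) \<le> 1" using ij by (simp add: M_def)
    qed
  qed
  \<comment> \<open>The factor \<open>t\<close> brings a basis into the unit ball, which shows that the supremum is positive.\<close>
  define t where "t = 1 / (1 + (\<Sum>i<n. psum s (e i)))"
  have S0: "0 \<le> (\<Sum>i<n. psum s (e i))" by (intro sum_nonneg psum_nonneg ls eE) auto
  have t: "0 < t" "t \<le> 1" using S0 by (auto simp: t_def)
  have te: "(\<lambda>i k. of_real t * e i k) \<in> F"
    unfolding F_def
  proof (clarify, intro conjI)
    fix i assume i: "i < n"
    show "(\<lambda>k. of_real t * e i k) \<in> E"
      using seq.subspace_scale[OF E(1) eE[OF i], of "of_real t"] by (simp add: seq_scale_def)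
    have "psum s (\<lambda>k. of_real t * e i k) = t powr s * psum s (e i)"
      using psum_scale(2)[OF ls[OF eE[OF i]], of t] t by (simp add: scaleR_conv_of_real)
    also have "\<dots> \<le> t powr 1 * psum s (e i)"
      using t s by (intro mult_right_mono powr_mono' psum_nonneg ls eE i) auto
    also have "\<dots> \<le> 1"
    proof -
      have "psum s (e i) \<le> (\<Sum>i<n. psum s (e i))"
        using i by (intro member_le_sum psum_nonneg ls eE) auto
      then show ?thesis using S0 by (simp add: t_def)
    qed
    finally show "psum s (\<lambda>k. of_real t * e i k) \<le> 1" .
  qed
  have "D (\<lambda>i k. of_real t * e i k) > 0"
  proof -
    have "M (\<lambda>i k. of_real t * e i k) = of_real t \<cdot>\<^sub>m M e"
      by (rule eq_matI) (auto simp: M_def)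
    then show ?thesis using \<kappa> t unfolding D_def by (simp add: M_def)
  qed
  then have pos: "0 < Sup (D ` F)"
    using cSup_upper[OF imageI[OF te, of D] bdd] by linarith
  then obtain x where x: "x \<in> F" "Sup (D ` F) / 2 < D x"
    using less_cSup_iff[of "D ` F" "Sup (D ` F) / 2"] te bdd by auto
  show ?thesis
  proof
    show "\<forall>i<n. x i \<in> E \<and> psum s (x i) \<le> 1" using x by (simp add: F_def)
    show "\<forall>a. \<forall>j<n. norm (a j) \<le> 2 * psum s (\<lambda>k. \<Sum>i<n. a i * x i k) powr (1 / s)"
    proof (intro allI impI)
      fix a :: "nat \<Rightarrow> 'a" and j assume j: "j < n"
      have xE: "x i \<in> E" if "i < n" for i using x that by (auto simp: F_def)
      have cramer: "D (x(j := (\<lambda>k. \<Sum>i<n. b i * x i k))) = norm (b j) * D x" for b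
      proof -
        have "M (x(j := (\<lambda>k. \<Sum>i<n. b i * x i k))) = replace_col (M x) (M x *\<^sub>v vec n b) j"
          by (rule eq_matI)
            (auto simp: M_def replace_col_def scalar_prod_def atLeast0LessThan mult.commute intro!: sum.cong)
        then show ?thesis
          using cramer_lemma_mat[OF Mc[of x], of "vec n b" j] j by (simp add: D_def norm_mult)
      qed
      define y where "y = (\<lambda>k. \<Sum>i<n. a i * x i k)"
      have yE: "y \<in> E" unfolding y_def by (rule seq_subspace_sum[OF E(1)]) (use xE in auto)
      show "norm (a j) \<le> 2 * psum s (\<lambda>k. \<Sum>i<n. a i * x i k) powr (1 / s)"
      proof (cases "psum s y = 0")
        case True
        have "y = (\<lambda>k. 0)" using psum_eq_0[OF ls[OF yE] True] by auto
        then have "M (x(j := y)) = replace_col (M x) (M x *\<^sub>v vec n (\<lambda>_. 0)) j"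
          by (intro eq_matI) (auto simp: M_def replace_col_def scalar_prod_def)
        then have "D (x(j := y)) = 0"
          using cramer_lemma_mat[OF Mc[of x], of "vec n (\<lambda>_. 0)" j] j by (simp add: D_def)
        then have "a j = 0" using cramer[of a] x(2) pos unfolding y_def by auto
        then show ?thesis by simp
      next
        case False
        define N where "N = psum s y powr (1 / s)"
        have py: "psum s y > 0" using False psum_nonneg[OF ls[OF yE]] by linarith
        then have N: "N > 0" unfolding N_def by simp
        define b where "b = (\<lambda>i. of_real (1 / N) * a i)"
        have yb: "(\<lambda>k. \<Sum>i<n. b i * x i k) = (\<lambda>k. (1 / N) *\<^sub>R y k)"
          by (simp add: b_def y_def scaleR_conv_of_real sum_distrib_left mult.assoc)
        have "psum s (\<lambda>k. (1 / N) *\<^sub>R y k) = \<bar>1 / N\<bar> powr s * psum s y"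
          by (rule psum_scale(2)[OF ls[OF yE]])
        also have "\<dots> = 1"
          using N py s by (simp add: powr_divide N_def powr_powr)
        finally have "psum s (\<lambda>k. \<Sum>i<n. b i * x i k) \<le> 1" unfolding yb by simp
        moreover have "(\<lambda>k. \<Sum>i<n. b i * x i k) \<in> E"
          by (rule seq_subspace_sum[OF E(1)]) (use xE in auto)
        ultimately have "x(j := (\<lambda>k. \<Sum>i<n. b i * x i k)) \<in> F"
          using x(1) by (auto simp: F_def)
        then have "D (x(j := (\<lambda>k. \<Sum>i<n. b i * x i k))) \<le> Sup (D ` F)"
          by (intro cSup_upper bdd imageI)
        then have "norm (b j) * D x \<le> 2 * D x"
          unfolding cramer using x(2) by linarith
        moreover have "D x > 0" using x(2) pos by linarith
        ultimately have "norm (b j) \<le> 2" by simp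
        then show ?thesis using N unfolding y_def[symmetric] N_def[symmetric]
          by (simp add: b_def norm_mult norm_divide divide_le_eq)
      qed
    qed
  qed
qed

section \<open>Orthonormal families at one scale\<close>

text \<open>
  Gaussian elimination: an equation with a nonzero coefficient at \<open>p\<close> is used to eliminate the unknown \<open>a p\<close>
  from the other equations.
\<close>
lemma underdetermined_system:
  fixes g :: "'u \<Rightarrow> 'i \<Rightarrow> real"
  assumes "finite U" "finite I" "card U < card I"
  shows "\<exists>a. (\<exists>i\<in>I. a i \<noteq> 0) \<and> (\<forall>u\<in>U. (\<Sum>i\<in>I. a i * g u i) = 0)"
  using assms
proof (induction U arbitrary: I g)
  case empty
  then have "I \<noteq> {}" by auto
  then show ?case by (intro exI[of _ "\<lambda>_. 1"]) auto
next
  case (insert u U)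
  show ?case
  proof (cases "\<forall>i\<in>I. g u i = 0")
    case True
    have "card U < card I" using insert by simp
    from insert.IH[OF insert.prems(1) this, of g] obtain a
      where "\<exists>i\<in>I. a i \<noteq> 0" "\<forall>u\<in>U. (\<Sum>i\<in>I. a i * g u i) = 0" by blast
    then show ?thesis using True by (intro exI[of _ a]) auto
  next
    case False
    then obtain p where p: "p \<in> I" "g u p \<noteq> 0" by auto
    define I' where "I' = I - {p}"
    have I': "finite I'" "card U < card I'" "I = insert p I'" "p \<notin> I'"
      using insert p by (auto simp: I'_def)
    define g' where "g' = (\<lambda>w i. g w i - g w p / g u p * g u i)"
    from insert.IH[OF I'(1,2), of g'] obtain a
      where a: "\<exists>i\<in>I'. a i \<noteq> 0" "\<forall>w\<in>U. (\<Sum>i\<in>I'. a i * g' w i) = 0" by blast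
    define b where "b = a(p := - (\<Sum>i\<in>I'. a i * g u i) / g u p)"
    have split: "(\<Sum>i\<in>I. b i * g w i) = b p * g w p + (\<Sum>i\<in>I'. a i * g w i)" for w
    proof -
      have "(\<Sum>i\<in>I'. b i * g w i) = (\<Sum>i\<in>I'. a i * g w i)"
        using I'(4) by (intro sum.cong) (auto simp: b_def)
      then show ?thesis using I' by simp
    qed
    have "(\<Sum>i\<in>I. b i * g u i) = 0" unfolding split using p by (simp add: b_def)
    moreover have "(\<Sum>i\<in>I. b i * g w i) = 0" if "w \<in> U" for w
    proof -
      have "0 = (\<Sum>i\<in>I'. a i * g' w i)" using a that by simp
      also have "\<dots> = (\<Sum>i\<in>I'. a i * g w i) - g w p / g u p * (\<Sum>i\<in>I'. a i * g u i)"
        unfolding g'_def sum_distrib_left sum_subtractf[symmetric]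
        by (intro sum.cong refl) (simp add: algebra_simps)
      also have "\<dots> = (\<Sum>i\<in>I. b i * g w i)" unfolding split using p by (simp add: b_def)
      finally show ?thesis by simp
    qed
    moreover have "\<exists>i\<in>I. b i \<noteq> 0" using a(1) I' by (auto simp: b_def)
    ultimately show ?thesis by (intro exI[of _ b]) auto
  qed
qed

text \<open>
  Vectors of \<open>\<real>\<^sup>n\<close> are represented by functions of which only the values below \<open>n\<close> count, because \<open>n\<close> is
  chosen in the course of the proof and cannot be a type.
\<close>
definition ip :: "nat \<Rightarrow> (nat \<Rightarrow> real) \<Rightarrow> (nat \<Rightarrow> real) \<Rightarrow> real" where
  "ip n a b = (\<Sum>i<n. a i * b i)"

definition orthonormal :: "nat \<Rightarrow> nat \<Rightarrow> (nat \<Rightarrow> nat \<Rightarrow> real) \<Rightarrow> bool" where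
  "orthonormal n m v \<longleftrightarrow> (\<forall>i<m. \<forall>j<m. ip n (v i) (v j) = (if i = j then 1 else 0))"

lemma ip_self_nonneg: "0 \<le> ip n a a" by (simp add: ip_def sum_nonneg)

lemma ip_commute: "ip n a b = ip n b a" by (simp add: ip_def mult.commute)

lemma ip_scale: "ip n (\<lambda>i. c * a i) b = c * ip n a b"
  by (simp add: ip_def sum_distrib_left mult.assoc)

lemma ip_sum: "ip n (\<lambda>i. \<Sum>j\<in>J. w j * v j i) b = (\<Sum>j\<in>J. w j * ip n (v j) b)"
  unfolding ip_def sum_distrib_left sum_distrib_right by (subst sum.swap) (simp add: mult.assoc)

lemma ip_combination:
  assumes "orthonormal n m v"
  shows "ip n (\<lambda>i. \<Sum>j<m. w j * v j i) (\<lambda>i. \<Sum>j<m. w j * v j i) = (\<Sum>j<m. (w j)\<^sup>2)"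
proof -
  have "ip n (v l) (\<lambda>i. \<Sum>j<m. w j * v j i) = w l" if "l < m" for l
  proof -
    have "ip n (v l) (\<lambda>i. \<Sum>j<m. w j * v j i) = (\<Sum>j<m. w j * ip n (v j) (v l))"
      by (subst ip_commute) (rule ip_sum)
    also have "\<dots> = (\<Sum>j<m. if j = l then w j else 0)"
      using assms that by (intro sum.cong) (auto simp: orthonormal_def)
    finally show ?thesis using that by simp
  qed
  then show ?thesis unfolding ip_sum by (simp add: power2_eq_square)
qed

lemma exists_unit_orthogonal:
  assumes "finite U" "card U < n"
  shows "\<exists>a. (\<forall>u\<in>U. ip n a u = 0) \<and> ip n a a = 1"
proof -
  obtain a where a: "\<exists>i<n. a i \<noteq> 0" "\<forall>u\<in>U. ip n a u = 0"
    using underdetermined_system[of U "{..<n}" "\<lambda>u i. u i"] assms unfolding ip_def by auto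
  then obtain i where i: "i < n" "a i \<noteq> 0" by auto
  have "(a i)\<^sup>2 \<le> ip n a a"
    unfolding ip_def power2_eq_square using i by (intro member_le_sum[of i "{..<n}"]) auto
  then have pos: "0 < ip n a a" using i by (meson less_le_trans zero_less_power2)
  define b where "b = (\<lambda>i. (1 / sqrt (ip n a a)) * a i)"
  have "ip n b b = (1 / sqrt (ip n a a)) * ((1 / sqrt (ip n a a)) * ip n a a)"
    unfolding b_def by (subst ip_scale, subst ip_commute, subst ip_scale) simp
  also have "\<dots> = 1" using pos by (simp add: field_simps)
  finally have "ip n b b = 1" .
  moreover have "\<forall>u\<in>U. ip n b u = 0" unfolding b_def ip_scale using a by simp
  ultimately show ?thesis by blast
qed

text \<open>
  Greedy choice: unit vectors orthogonal to \<open>U\<close> and to each other, on which \<open>N\<close> exceeds \<open>\<tau>\<close>, are collected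
  until there are \<open>m\<close> of them or no further one exists.
\<close>
lemma orthonormal_extension:
  assumes U: "finite U" and \<tau>: "0 \<le> \<tau>"
    and hom: "\<And>c a. N (\<lambda>i. c * a i) = \<bar>c\<bar> * N a"
    and N0: "\<And>a. ip n a a = 0 \<Longrightarrow> N a = 0"
  shows "(\<exists>v. orthonormal n m v \<and> (\<forall>i<m. \<forall>u\<in>U. ip n (v i) u = 0) \<and> (\<forall>i<m. \<tau> < N (v i)))
    \<or> (\<exists>U'. finite U' \<and> U \<subseteq> U' \<and> card U' \<le> card U + m \<and>
         (\<forall>a. (\<forall>u\<in>U'. ip n a u = 0) \<longrightarrow> N a \<le> \<tau> * sqrt (ip n a a)))"
proof (induction m)
  case 0
  show ?case by (simp add: orthonormal_def)
next
  case (Suc m)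
  then show ?case
  proof
    assume "\<exists>U'. finite U' \<and> U \<subseteq> U' \<and> card U' \<le> card U + m \<and>
         (\<forall>a. (\<forall>u\<in>U'. ip n a u = 0) \<longrightarrow> N a \<le> \<tau> * sqrt (ip n a a))"
    then show ?thesis by (metis add_Suc_right le_Suc_eq)
  next
    assume "\<exists>v. orthonormal n m v \<and> (\<forall>i<m. \<forall>u\<in>U. ip n (v i) u = 0) \<and> (\<forall>i<m. \<tau> < N (v i))"
    then obtain v where v: "orthonormal n m v" "\<forall>i<m. \<forall>u\<in>U. ip n (v i) u = 0" "\<forall>i<m. \<tau> < N (v i)"
      by blast
    define U' where "U' = U \<union> v ` {..<m}"
    have fin: "finite U'" "U \<subseteq> U'" using U by (auto simp: U'_def)
    have "card U' \<le> card U + card (v ` {..<m})" unfolding U'_def by (rule card_Un_le)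
    also have "card (v ` {..<m}) \<le> m" using card_image_le[of "{..<m}" v] by simp
    finally have card: "card U' \<le> card U + Suc m" by simp
    show ?thesis
    proof (cases "\<forall>a. (\<forall>u\<in>U'. ip n a u = 0) \<longrightarrow> N a \<le> \<tau> * sqrt (ip n a a)")
      case True
      then show ?thesis using fin card by blast
    next
      case False
      then obtain a where a: "\<forall>u\<in>U'. ip n a u = 0" "\<tau> * sqrt (ip n a a) < N a" by force
      have "ip n a a \<noteq> 0" using a(2) N0[of a] by auto
      then have pos: "0 < ip n a a" using ip_self_nonneg[of n a] by linarith
      define r where "r = sqrt (ip n a a)"
      have r: "r > 0" "r * r = ip n a a" using pos by (auto simp: r_def)
      define b where "b = (\<lambda>i. (1 / r) * a i)"
      have bu: "ip n b u = 0" if "u \<in> U'" for u using a that unfolding b_def ip_scale by simp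
      have "ip n b b = (1 / r) * ((1 / r) * ip n a a)"
        unfolding b_def by (subst ip_scale, subst ip_commute, subst ip_scale) simp
      then have bb: "ip n b b = 1" using r pos by (simp add: field_simps)
      have "N b = (1 / r) * N a" unfolding b_def hom using r by simp
      then have Nb: "\<tau> < N b" using a(2) r unfolding r_def[symmetric] by (simp add: pos_less_divide_eq)
      define v' where "v' = v(m := b)"
      have vb: "ip n (v i) b = 0" if "i < m" for i
        using bu[of "v i"] that by (simp add: U'_def ip_commute)
      have bv: "ip n b (v i) = 0" if "i < m" for i
        using bu[of "v i"] that by (simp add: U'_def)
      have "orthonormal n (Suc m) v'"
        using v(1) bb vb bv unfolding orthonormal_def v'_def by (auto simp: less_Suc_eq)
      moreover have "\<forall>i<Suc m. \<forall>u\<in>U. ip n (v' i) u = 0"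
        using v(2) bu fin by (auto simp: v'_def less_Suc_eq)
      moreover have "\<forall>i<Suc m. \<tau> < N (v' i)"
        using v(3) Nb by (auto simp: v'_def less_Suc_eq)
      ultimately show ?thesis by blast
    qed
  qed
qed

text \<open>
  Start with \<open>N \<le> c0\<close> on the unit sphere. If fewer than \<open>m\<close> orthonormal vectors with \<open>N > c0 / 2\<close> can be found,
  passing to the orthogonal complement of a maximal family of them halves the bound at the cost of
  at most \<open>m\<close> dimensions. This cannot happen \<open>J\<close> times, since some dimension would be left while \<open>N\<close> is at
  least \<open>1 / c1\<close> on unit vectors. The first failure to halve the bound gives the family, with \<open>c\<close> the bound
  reached by then.
\<close>
lemma large_orthonormal_family:
  assumes c0: "0 < c0" and c1: "0 < c1" and up: "\<And>a. N a \<le> c0 * sqrt (ip n a a)"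
    and lo: "\<And>a. sqrt (ip n a a) \<le> c1 * N a"
    and hom: "\<And>c a. N (\<lambda>i. c * a i) = \<bar>c\<bar> * N a"
    and N0: "\<And>a. ip n a a = 0 \<Longrightarrow> N a = 0"
    and J: "J * m < n" "c0 * c1 < 2 ^ J"
  obtains c v where "0 < c" "orthonormal n m v" "\<And>i. i < m \<Longrightarrow> c / 2 < N (v i)"
    "\<And>w. N (\<lambda>i. \<Sum>j<m. w j * v j i) \<le> c * L2_set w {..<m}"
proof -
  define good where "good = (\<lambda>c v. 0 < c \<and> orthonormal n m v \<and> (\<forall>i<m. c / 2 < N (v i)) \<and>
    (\<forall>w. N (\<lambda>i. \<Sum>j<m. w j * v j i) \<le> c * L2_set w {..<m}))"
  have step: "(\<exists>c v. good c v) \<or> (\<exists>U. finite U \<and> card U \<le> j * m \<and>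
      (\<forall>a. (\<forall>u\<in>U. ip n a u = 0) \<longrightarrow> N a \<le> c0 / 2 ^ j * sqrt (ip n a a)))" for j
  proof (induction j)
    case 0
    show ?case using up by (intro disjI2 exI[of _ "{}"]) auto
  next
    case (Suc j)
    then show ?case
    proof
      assume "\<exists>U. finite U \<and> card U \<le> j * m \<and>
        (\<forall>a. (\<forall>u\<in>U. ip n a u = 0) \<longrightarrow> N a \<le> c0 / 2 ^ j * sqrt (ip n a a))"
      then obtain U where U: "finite U" "card U \<le> j * m"
        "\<And>a. (\<forall>u\<in>U. ip n a u = 0) \<Longrightarrow> N a \<le> c0 / 2 ^ j * sqrt (ip n a a)" by blast
      have "0 \<le> c0 / 2 ^ Suc j" using c0 by simp
      from orthonormal_extension[where N=N and m=m and n=n, OF U(1) this hom N0] show ?thesis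
      proof
        assume "\<exists>v. orthonormal n m v \<and> (\<forall>i<m. \<forall>u\<in>U. ip n (v i) u = 0) \<and> (\<forall>i<m. c0 / 2 ^ Suc j < N (v i))"
        then obtain v where v: "orthonormal n m v" "\<forall>i<m. \<forall>u\<in>U. ip n (v i) u = 0"
          "\<forall>i<m. c0 / 2 ^ Suc j < N (v i)" by blast
        have "N (\<lambda>i. \<Sum>j<m. w j * v j i) \<le> c0 / 2 ^ j * L2_set w {..<m}" for w
        proof -
          have "\<forall>u\<in>U. ip n (\<lambda>i. \<Sum>j<m. w j * v j i) u = 0"
            unfolding ip_sum using v(2) by simp
          from U(3)[OF this] show ?thesis
            unfolding ip_combination[OF v(1)] L2_set_def .
        qed
        then have "good (c0 / 2 ^ j) v" using v c0 by (auto simp: good_def field_simps)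
        then show ?thesis by blast
      next
        assume "\<exists>U'. finite U' \<and> U \<subseteq> U' \<and> card U' \<le> card U + m \<and>
         (\<forall>a. (\<forall>u\<in>U'. ip n a u = 0) \<longrightarrow> N a \<le> c0 / 2 ^ Suc j * sqrt (ip n a a))"
        then obtain U' where "finite U'" "card U' \<le> card U + m"
          "\<forall>a. (\<forall>u\<in>U'. ip n a u = 0) \<longrightarrow> N a \<le> c0 / 2 ^ Suc j * sqrt (ip n a a)" by blast
        then show ?thesis using U(2) by (intro disjI2 exI[of _ U']) auto
      qed
    qed blast
  qed
  have "\<nexists>U. finite U \<and> card U \<le> J * m \<and>
      (\<forall>a. (\<forall>u\<in>U. ip n a u = 0) \<longrightarrow> N a \<le> c0 / 2 ^ J * sqrt (ip n a a))"
  proof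
    assume "\<exists>U. finite U \<and> card U \<le> J * m \<and>
      (\<forall>a. (\<forall>u\<in>U. ip n a u = 0) \<longrightarrow> N a \<le> c0 / 2 ^ J * sqrt (ip n a a))"
    then obtain U where U: "finite U" "card U \<le> J * m"
      "\<forall>a. (\<forall>u\<in>U. ip n a u = 0) \<longrightarrow> N a \<le> c0 / 2 ^ J * sqrt (ip n a a)" by blast
    obtain a where a: "\<forall>u\<in>U. ip n a u = 0" "ip n a a = 1"
      using exists_unit_orthogonal[of U n] U J by auto
    have Na: "N a \<le> c0 / 2 ^ J" using U(3) a by force
    have ge: "1 \<le> c1 * N a" using lo[of a] a by simp
    have "c1 * N a \<le> c1 * (c0 / 2 ^ J)" using Na c1 by (intro mult_left_mono) auto
    also have "\<dots> < 1" using J(2) by (simp add: field_simps)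
    finally show False using ge by simp
  qed
  with step[of J] obtain c v where "good c v" by blast
  then show ?thesis using that unfolding good_def by blast
qed

section \<open>Weakly bounded tuples in subspaces of large dimension\<close>

lemma exists_dimension: "\<exists>k::nat. (3 * k + 2) * m < 2 ^ k" for m :: nat
proof (cases "m = 0")
  case False
  have "8 * m < 2 ^ (8 * m)" by (rule less_exp)
  then have "(8 * m) * (8 * m) < 2 ^ (8 * m) * 2 ^ (8 * m)"
    by (intro mult_strict_mono) auto
  then have "(8 * m) * (8 * m) < 2 ^ (16 * m)" by (simp flip: power_add)
  moreover have "(3 * (16 * m) + 2) * m \<le> (8 * m) * (8 * m)"
    using False by (simp add: algebra_simps)
  ultimately show ?thesis by (intro exI[of _ "16 * m"]) linarith
qed auto

lemma psummable_combination:
  assumes "finite I" "0 < s" "\<And>i. i \<in> I \<Longrightarrow> psummable s (x i)"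
  shows "psummable s (\<lambda>k. \<Sum>i\<in>I. a i *\<^sub>R x i k)"
  by (rule psum_sum(1)) (use assms in \<open>auto intro: psum_scale(1)\<close>)

text \<open>
  Coordinates with respect to an Auerbach system identify \<open>E\<close> with \<open>\<real>\<^sup>n\<close> (only real coefficients are used, also
  over the complex scalars). The two norms satisfy \<open>N \<le> n\<^sup>2 |\<cdot>|\<close> and \<open>|\<cdot>| \<le> 2 n N\<close>, so that about
  \<open>3 log n\<close> halvings of the bound on \<open>N\<close> exhaust all scales, and \<open>n\<close> can be chosen so large that these
  halvings use up fewer than \<open>n\<close> dimensions.
\<close>
lemma hilbertian_system:
  fixes s :: real and m :: nat
  assumes s: "1 \<le> s"
  shows "\<exists>n\<ge>1. \<forall>E::(nat \<Rightarrow> 'a::real_normed_field) set.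
    seq.subspace E \<and> seq.dim E = n \<and> (\<forall>x\<in>E. psummable s x) \<longrightarrow>
    (\<exists>f. (\<forall>i<m. f i \<in> E) \<and> (\<forall>i<m. (1 / 2) powr s \<le> psum s (f i)) \<and>
      (\<forall>w. psum s (\<lambda>k. \<Sum>i<m. w i *\<^sub>R f i k) \<le> L2_set w {..<m} powr s))"
proof -
  obtain k where k: "(3 * k + 2) * m < 2 ^ k" using exists_dimension[of m] by blast
  define n :: nat where "n = 2 ^ k"
  have n: "1 \<le> n" by (simp add: n_def)
  show ?thesis
  proof (intro exI[of _ n] conjI allI impI n)
    fix E :: "(nat \<Rightarrow> 'a) set"
    assume "seq.subspace E \<and> seq.dim E = n \<and> (\<forall>x\<in>E. psummable s x)"
    then have E: "seq.subspace E" "seq.dim E = n" and ls: "\<And>x. x \<in> E \<Longrightarrow> psummable s x" by auto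
    obtain x where x: "\<forall>i<n. x i \<in> E \<and> psum s (x i) \<le> 1"
      and co: "\<forall>a. \<forall>j<n. norm (a j) \<le> 2 * psum s (\<lambda>k. \<Sum>i<n. a i * x i k) powr (1 / s)"
      by (rule auerbach_system[OF E n s ls])
    have xE: "x i \<in> E" and x1: "psum s (x i) \<le> 1" if "i < n" for i using x that by auto
    define L where "L = (\<lambda>a k. \<Sum>i<n. a i *\<^sub>R x i k)"
    have LE: "L a \<in> E" for a
      unfolding L_def scaleR_conv_of_real by (rule seq_subspace_sum[OF E(1)]) (use xE in auto)
    define N where "N = (\<lambda>a. psum s (L a) powr (1 / s))"
    have Ns: "N a powr s = psum s (L a)" for a
      unfolding N_def using s psum_nonneg[OF ls[OF LE[of a]]] by (simp add: powr_powr)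
    have scale: "N (\<lambda>i. c * a i) = \<bar>c\<bar> * N a" for c a
    proof -
      have "L (\<lambda>i. c * a i) = (\<lambda>k. c *\<^sub>R L a k)" by (simp add: L_def scaleR_sum_right)
      then have "psum s (L (\<lambda>i. c * a i)) = \<bar>c\<bar> powr s * psum s (L a)"
        using psum_scale(2)[OF ls[OF LE[of a]], of c] by simp
      then show ?thesis
        using s by (simp add: N_def powr_mult powr_powr psum_nonneg[OF ls[OF LE[of a]]])
    qed
    have ipL: "sqrt (ip n a a) = L2_set a {..<n}" for a
      by (simp add: ip_def L2_set_def power2_eq_square)
    have abs_le: "\<bar>a i\<bar> \<le> L2_set a {..<n}" if "i < n" for a i
      using member_le_L2_set[of "{..<n}" i "\<lambda>i. \<bar>a i\<bar>"] that by (simp add: L2_set_def)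
    have N0: "N a = 0" if "ip n a a = 0" for a
    proof -
      have "a i = 0" if "i < n" for i
        using abs_le[of i a] \<open>ip n a a = 0\<close> that by (simp add: ipL[symmetric])
      then have "L a = (\<lambda>k. 0)" by (simp add: L_def)
      then show ?thesis by (simp add: N_def psum_def)
    qed
    have up: "N a \<le> real n ^ 2 * sqrt (ip n a a)" for a
    proof -
      let ?l = "L2_set a {..<n}"
      have "psum s (L a) \<le> real n powr s * (\<Sum>i<n. psum s (\<lambda>k. a i *\<^sub>R x i k))"
        unfolding L_def using psum_sum(2)[of "{..<n}" s "\<lambda>i k. a i *\<^sub>R x i k"] s ls xE
        by (simp add: psum_scale(1))
      also have "\<dots> \<le> real n powr s * (\<Sum>i<n. ?l powr s)"
      proof (intro mult_left_mono sum_mono)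
        fix i assume i: "i \<in> {..<n}"
        have "psum s (\<lambda>k. a i *\<^sub>R x i k) = \<bar>a i\<bar> powr s * psum s (x i)"
          using psum_scale(2)[OF ls[OF xE], of i "a i"] i by simp
        also have "\<dots> \<le> ?l powr s * 1"
          using i s abs_le[of i a] x1[of i] psum_nonneg[OF ls[OF xE], of i]
          by (intro mult_mono powr_mono2) auto
        finally show "psum s (\<lambda>k. a i *\<^sub>R x i k) \<le> ?l powr s" by simp
      qed auto
      also have "\<dots> = real n powr s * (real n powr 1 * ?l powr s)" by simp
      also have "\<dots> \<le> real n powr s * (real n powr s * ?l powr s)"
        using s n by (intro mult_left_mono mult_right_mono powr_mono) auto
      also have "\<dots> = (real n ^ 2 * ?l) powr s"
        by (simp add: powr_mult power2_eq_square)
      finally have "psum s (L a) powr (1 / s) \<le> ((real n ^ 2 * ?l) powr s) powr (1 / s)"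
        using s psum_nonneg[OF ls[OF LE[of a]]] by (intro powr_mono2) auto
      also have "\<dots> = real n ^ 2 * ?l" using s by (simp add: powr_powr)
      finally show ?thesis by (simp add: N_def ipL)
    qed
    have lo: "sqrt (ip n a a) \<le> (2 * real n) * N a" for a
    proof -
      have "L2_set a {..<n} \<le> (\<Sum>i<n. \<bar>a i\<bar>)" by (rule L2_set_le_sum_abs)
      also have "\<dots> \<le> (\<Sum>i<n. 2 * N a)"
        using spec[OF co, of "\<lambda>i. of_real (a i)"]
        by (intro sum_mono) (auto simp: N_def L_def scaleR_conv_of_real)
      finally show ?thesis by (simp add: ipL)
    qed
    have J: "(3 * k + 2) * m < n" "real n ^ 2 * (2 * real n) < 2 ^ (3 * k + 2)"
      using k by (auto simp: n_def power_add power_mult[symmetric] power_mult mult.commute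
          power3_eq_cube power2_eq_square power_mult_distrib[symmetric])
    obtain c v where c: "0 < c" and v: "\<And>i. i < m \<Longrightarrow> c / 2 < N (v i)"
      and w: "\<And>w. N (\<lambda>i. \<Sum>j<m. w j * v j i) \<le> c * L2_set w {..<m}"
      by (rule large_orthonormal_family[where N=N, OF _ _ up lo scale N0 J]) (use n in auto)
    define f where "f = (\<lambda>i k. (1 / c) *\<^sub>R L (v i) k)"
    have "f i \<in> E" for i
      using seq.subspace_scale[OF E(1) LE[of "v i"], of "of_real (1 / c)"]
      by (simp add: f_def seq_scale_def scaleR_conv_of_real)
    moreover have "(1 / 2) powr s \<le> psum s (f i)" if "i < m" for i
    proof -
      have "psum s (f i) = (1 / c) powr s * N (v i) powr s"
        unfolding f_def Ns using psum_scale(2)[OF ls[OF LE[of "v i"]], of "1 / c"] c by simp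
      also have "\<dots> = (N (v i) / c) powr s" using c by (simp add: powr_divide N_def)
      also have "\<dots> \<ge> (1 / 2) powr s"
        using v[OF that] c s by (intro powr_mono2) (auto simp: field_simps)
      finally show ?thesis .
    qed
    moreover have "psum s (\<lambda>k. \<Sum>i<m. w' i *\<^sub>R f i k) \<le> L2_set w' {..<m} powr s" for w'
    proof -
      let ?b = "\<lambda>i. \<Sum>j<m. w' j * v j i"
      have "(\<Sum>i<m. w' i *\<^sub>R f i k) = (1 / c) *\<^sub>R L ?b k" for k
        unfolding f_def L_def scaleR_sum_left scaleR_sum_right
        by (subst sum.swap) (simp add: mult.commute mult.left_commute)
      then have "psum s (\<lambda>k. \<Sum>i<m. w' i *\<^sub>R f i k) = (1 / c) powr s * N ?b powr s"
        unfolding Ns using psum_scale(2)[OF ls[OF LE[of ?b]], of "1 / c"] c by simp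
      also have "\<dots> \<le> (1 / c) powr s * (c * L2_set w' {..<m}) powr s"
        using w[of w'] s by (intro mult_left_mono powr_mono2) (auto simp: N_def)
      also have "\<dots> = L2_set w' {..<m} powr s"
        using c by (simp add: powr_mult powr_divide)
      finally show ?thesis .
    qed
    ultimately show "\<exists>f. (\<forall>i<m. f i \<in> E) \<and> (\<forall>i<m. (1 / 2) powr s \<le> psum s (f i)) \<and>
      (\<forall>w. psum s (\<lambda>k. \<Sum>i<m. w i *\<^sub>R f i k) \<le> L2_set w {..<m} powr s)"
      by (intro exI[of _ f]) auto
  qed
qed

lemma square_function_summable:
  fixes f :: "nat \<Rightarrow> nat \<Rightarrow> 'b::real_normed_vector" and m :: nat
  assumes "0 < s" "\<And>i. i < m \<Longrightarrow> psummable s (f i)"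
  shows "summable (\<lambda>k. L2_set (\<lambda>i. norm (f i k)) {..<m} powr s)"
proof (rule summable_comparison_test')
  show "summable (\<lambda>k. real m powr s * (\<Sum>i<m. norm (f i k) powr s))"
    using assms(2) unfolding psummable_def by (intro summable_mult summable_sum) auto
  fix k :: nat
  have "L2_set (\<lambda>i. norm (f i k)) {..<m} powr s \<le> (\<Sum>i<m. norm (f i k)) powr s"
    using assms by (intro powr_mono2 L2_set_le_sum) auto
  also have "\<dots> \<le> real m powr s * (\<Sum>i<m. norm (f i k) powr s)"
    using powr_sum_le[of "{..<m}" s "\<lambda>i. norm (f i k)"] assms by simp
  finally show "norm (L2_set (\<lambda>i. norm (f i k)) {..<m} powr s)
      \<le> real m powr s * (\<Sum>i<m. norm (f i k) powr s)" by simp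
qed

text \<open>
  For \<open>0 \<le> u \<le> 1\<close> one has \<open>u\<^sup>s \<le> u \<le> \<eta> + u\<^sup>2 / \<eta>\<close>. Apply this to \<open>u = norm (f i k) / F(k)\<close>, where
  \<open>F(k)\<close> is the Euclidean length of \<open>(f i k)\<^sub>i\<close>. The sum over \<open>i\<close> of the squares \<open>u\<^sup>2\<close> is \<open>1\<close>, so
  summing over \<open>i\<close> and \<open>k\<close> bounds \<open>m / 4\<close> by \<open>m \<eta> + 1 / \<eta>\<close> times the sum in question, and
  \<open>\<eta> = 1 / sqrt m\<close> balances the two terms. This weak form of the cotype \<open>2\<close> inequality is
  sufficient because only growth with \<open>m\<close> matters.
\<close>
lemma square_function_large:
  fixes f :: "nat \<Rightarrow> nat \<Rightarrow> 'b::real_normed_vector"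
  assumes s: "1 \<le> s" "s \<le> 2" and m: "1 \<le> m"
    and ls: "\<And>i. i < m \<Longrightarrow> psummable s (f i)"
    and half: "\<And>i. i < m \<Longrightarrow> (1 / 2) powr s \<le> psum s (f i)"
  shows "sqrt (real m) / 8 \<le> (\<Sum>k. L2_set (\<lambda>i. norm (f i k)) {..<m} powr s)"
proof -
  define F where "F = (\<lambda>k. L2_set (\<lambda>i. norm (f i k)) {..<m})"
  define r where "r = sqrt (real m)"
  have r: "1 \<le> r" "r * r = real m" using m by (auto simp: r_def)
  have rdiv: "real m / r = r" using r(1) by (simp flip: r(2))
  have smF: "summable (\<lambda>k. F k powr s)"
    unfolding F_def by (rule square_function_summable) (use s ls in auto)
  have pw: "(\<Sum>i<m. norm (f i k) powr s) \<le> 2 * r * F k powr s" for k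
  proof (cases "F k = 0")
    case True
    then have "\<forall>i<m. norm (f i k) = 0" unfolding F_def by (subst (asm) L2_set_eq_0_iff) auto
    then show ?thesis using s r by (simp add: True)
  next
    case False
    then have F: "0 < F k" using L2_set_nonneg[of "\<lambda>i. norm (f i k)" "{..<m}"] unfolding F_def by linarith
    have FF: "(F k)\<^sup>2 = (\<Sum>i<m. (norm (f i k))\<^sup>2)"
      unfolding F_def L2_set_def by (simp add: sum_nonneg)
    have "norm (f i k) powr s \<le> F k powr s * (1 / r + r * ((norm (f i k))\<^sup>2 / (F k)\<^sup>2))" if "i < m" for i
    proof -
      define u where "u = norm (f i k) / F k"
      have u: "0 \<le> u" "u \<le> 1"
        using F member_le_L2_set[of "{..<m}" i "\<lambda>i. norm (f i k)"] that
        by (auto simp: u_def F_def)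
      have "u powr s \<le> u powr 1" using powr_mono'[of 1 s u] u s by simp
      also have "\<dots> \<le> 1 / r + r * u\<^sup>2"
      proof -
        have "0 \<le> (r * u - 1)\<^sup>2" by simp
        then have "2 * (r * u) \<le> 1 + r * r * u\<^sup>2" by (simp add: power2_eq_square algebra_simps)
        moreover have "0 \<le> r * u" using r u by simp
        ultimately have "r * u \<le> 1 + r * r * u\<^sup>2" by linarith
        then have "u \<le> (1 + r * r * u\<^sup>2) / r" using r by (simp add: field_simps)
        also have "\<dots> = 1 / r + r * u\<^sup>2" using r by (simp add: field_simps)
        finally show ?thesis using u by simp
      qed
      finally have "F k powr s * u powr s \<le> F k powr s * (1 / r + r * u\<^sup>2)"
        by (intro mult_left_mono) auto
      then show ?thesis using F by (simp add: u_def powr_divide power_divide)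
    qed
    then have "(\<Sum>i<m. norm (f i k) powr s)
        \<le> (\<Sum>i<m. F k powr s * (1 / r + r * ((norm (f i k))\<^sup>2 / (F k)\<^sup>2)))"
      by (intro sum_mono) auto
    also have "\<dots> = F k powr s * (real m / r + r * ((\<Sum>i<m. (norm (f i k))\<^sup>2) / (F k)\<^sup>2))"
      by (simp add: sum_distrib_left[symmetric] sum.distrib sum_divide_distrib[symmetric])
    also have "\<dots> = 2 * r * F k powr s"
      unfolding FF[symmetric] rdiv using F by simp
    finally show ?thesis .
  qed
  have "real m * (1 / 4) \<le> (\<Sum>i<m. psum s (f i))"
  proof -
    have "(1 / 2 :: real) powr 2 \<le> (1 / 2) powr s" using s by (intro powr_mono') auto
    then have "1 / 4 \<le> psum s (f i)" if "i < m" for i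
      using half[OF that] by (simp add: power2_eq_square)
    then show ?thesis using sum_bounded_below[of "{..<m}" "1 / 4" "\<lambda>i. psum s (f i)"] by simp
  qed
  also have "\<dots> = (\<Sum>k. \<Sum>i<m. norm (f i k) powr s)"
    unfolding psum_def using ls by (subst suminf_sum) (auto simp: psummable_def)
  also have "\<dots> \<le> (\<Sum>k. 2 * r * F k powr s)"
    by (intro suminf_le pw summable_sum summable_mult smF) (use ls in \<open>auto simp: psummable_def\<close>)
  also have "\<dots> = 2 * r * (\<Sum>k. F k powr s)" by (rule suminf_mult[OF smF])
  finally have "r * r \<le> r * (8 * (\<Sum>k. F k powr s))" using r by simp
  then have "r \<le> 8 * (\<Sum>k. F k powr s)" using r(1) by (subst (asm) mult_le_cancel_left_pos) auto
  then show ?thesis by (simp add: F_def r_def)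
qed

section \<open>From weak-to-strong estimates to small vectors\<close>

definition real_linear_on_psummable ::
  "real \<Rightarrow> ((nat \<Rightarrow> 'b::real_normed_vector) \<Rightarrow> nat \<Rightarrow> 'b) \<Rightarrow> bool" where
  "real_linear_on_psummable s T \<longleftrightarrow> (\<forall>(m::nat) f w. (\<forall>i<m. psummable s (f i)) \<longrightarrow>
     T (\<lambda>k. \<Sum>i<m. w i *\<^sub>R f i k) = (\<lambda>l. \<Sum>i<m. w i *\<^sub>R T (f i) l))"

text \<open>
  The hypothesis on the tuple says that \<open>w \<mapsto> \<Sum>\<^sub>i w i f i\<close> is a contraction from Euclidean space to \<open>\<ell>\<^sub>s\<close>. The
  conclusion is stated for partial sums, which makes the summability of the left-hand side part of it.
\<close>
definition weak_to_strong ::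
  "real \<Rightarrow> real \<Rightarrow> real \<Rightarrow> real \<Rightarrow> ((nat \<Rightarrow> 'b::real_normed_vector) \<Rightarrow> nat \<Rightarrow> 'b) \<Rightarrow> bool" where
  "weak_to_strong s q \<kappa> C T \<longleftrightarrow> (\<forall>(m::nat) f.
     (\<forall>i<m. psummable s (f i)) \<and>
     (\<forall>w. psum s (\<lambda>k. \<Sum>i<m. w i *\<^sub>R f i k) \<le> L2_set w {..<m} powr s) \<longrightarrow>
     (\<forall>K. (\<Sum>l<K. L2_set (\<lambda>i. norm (T (f i) l)) {..<m} powr q)
       \<le> C * (\<Sum>k. L2_set (\<lambda>i. norm (f i k)) {..<m} powr s) powr \<kappa>))"

lemma real_linearD:
  fixes m :: nat
  assumes "real_linear_on_psummable s T" "\<And>i. i < m \<Longrightarrow> psummable s (f i)"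
  shows "T (\<lambda>k. \<Sum>i<m. w i *\<^sub>R f i k) = (\<lambda>l. \<Sum>i<m. w i *\<^sub>R T (f i) l)"
  using assms(1)[unfolded real_linear_on_psummable_def, rule_format, of m f w] assms(2) by blast

text \<open>
  A tuple of length one is weakly bounded exactly if its entry lies in the unit ball.
\<close>
lemma weak_to_strong_imp_bounded:
  assumes T: "real_linear_on_psummable s T" "weak_to_strong s q \<kappa> C T"
    and s: "0 < s" "0 < q" "0 \<le> C" "0 \<le> \<kappa>" and x: "psummable s x"
  shows "psummable q (T x)" and "psum q (T x) powr (1 / q) \<le> C powr (1 / q) * psum s x powr (1 / s)"
proof -
  have scale: "T (\<lambda>k. c *\<^sub>R x k) = (\<lambda>l. c *\<^sub>R T x l)" for c
    using real_linearD[OF T(1), of "Suc 0" "\<lambda>_. x" "\<lambda>_. c"] x by simp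
  have "psummable q (T x) \<and> psum q (T x) powr (1 / q) \<le> C powr (1 / q) * psum s x powr (1 / s)"
  proof (cases "psum s x = 0")
    case True
    then have "x = (\<lambda>k. 0 *\<^sub>R x k)" using psum_eq_0[OF x] by auto
    then have "T x = (\<lambda>l. 0)" using scale[of 0] by simp
    then show ?thesis using s by (simp add: psummable_def psum_def)
  next
    case False
    define N where "N = psum s x powr (1 / s)"
    have px: "0 < psum s x" using False psum_nonneg[OF x] by linarith
    then have N: "0 < N" by (simp add: N_def)
    have Ns: "N powr s = psum s x" using px s by (simp add: N_def powr_powr)
    define y where "y = (\<lambda>k. (1 / N) *\<^sub>R x k)"
    have y: "psummable s y" unfolding y_def by (rule psum_scale(1)[OF x])
    have y1: "psum s y = 1"
      unfolding y_def psum_scale(2)[OF x] using N px by (simp add: powr_divide Ns)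
    have w: "psum s (\<lambda>k. \<Sum>i<Suc 0. w i *\<^sub>R y k) \<le> L2_set w {..<Suc 0} powr s" for w
      using psum_scale(2)[OF y, of "w 0"] y1 by (simp add: L2_set_def)
    have "(\<Sum>l<K. L2_set (\<lambda>i. norm (T y l)) {..<Suc 0} powr q)
       \<le> C * (\<Sum>k. L2_set (\<lambda>i. norm (y k)) {..<Suc 0} powr s) powr \<kappa>" for K
      using T(2)[unfolded weak_to_strong_def, rule_format, of "Suc 0" "\<lambda>_. y" K] y w by blast
    then have "(\<Sum>l<K. norm (T y l) powr q) \<le> C" for K
      using y1 by (simp add: L2_set_def psum_def)
    then have sm: "psummable q (T y)" and le: "psum q (T y) \<le> C"
      unfolding psummable_def psum_def
      by (auto intro!: summableI_nonneg_bounded[of _ C] suminf_le_const)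
    have Ty: "T y = (\<lambda>l. (1 / N) *\<^sub>R T x l)" unfolding y_def by (rule scale)
    have Tx: "T x = (\<lambda>l. N *\<^sub>R T y l)" using N by (simp add: Ty)
    have "psum q (T x) = N powr q * psum q (T y)"
      by (subst Tx) (use psum_scale(2)[OF sm, of N] N in simp)
    also have "\<dots> \<le> N powr q * C" using le by (intro mult_left_mono) auto
    finally have "psum q (T x) powr (1 / q) \<le> (N powr q * C) powr (1 / q)"
      using psum_nonneg[OF psum_scale(1)[OF sm, of N]] s by (intro powr_mono2) (auto simp: Tx[symmetric])
    also have "\<dots> = C powr (1 / q) * N" using N s by (simp add: powr_mult powr_powr)
    finally have "psum q (T x) powr (1 / q) \<le> C powr (1 / q) * N" .
    moreover have "psummable q (T x)"
      by (subst Tx) (rule psum_scale(1)[OF sm])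
    ultimately show ?thesis unfolding N_def by blast
  qed
  then show "psummable q (T x)" "psum q (T x) powr (1 / q) \<le> C powr (1 / q) * psum s x powr (1 / s)"
    by auto
qed

text \<open>
  A lower bound of the convex function \<open>a \<mapsto> a\<^sup>\<rho>\<close> by an affine one, weaker than the tangent, through which
  averages over signs can be taken without Jensen's inequality.
\<close>
lemma powr_tangent_le:
  fixes a t \<rho> :: real
  assumes "0 \<le> a" "0 < t" "1 \<le> \<rho>"
  shows "t powr (\<rho> - 1) * (a - t) \<le> a powr \<rho>"
proof (cases "t \<le> a")
  case True
  have "t powr (\<rho> - 1) * (a - t) \<le> a powr (\<rho> - 1) * a"
    using True assms by (intro mult_mono powr_mono2) auto
  also have "\<dots> = a powr \<rho>" using True assms by (simp add: powr_diff)
  finally show ?thesis .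
next
  case False
  then have "t powr (\<rho> - 1) * (a - t) \<le> 0" by (intro mult_nonneg_nonpos) auto
  then show ?thesis by (rule order_trans) simp
qed

text \<open>
  If \<open>\<parallel>T x\<parallel> > \<epsilon> \<parallel>x\<parallel>\<close> held for all the vectors \<open>x = \<Sum>\<^sub>i \<plusminus>f i\<close>, averaging the \<open>q\<close>-th powers would
  give, by the two Khinchine inequalities, \<open>\<epsilon>\<^sup>q W\<^sup>\<rho> \<le> const * W\<^sup>\<kappa>\<close> with \<open>\<rho> = q / s > \<kappa>\<close>. This bounds \<open>W\<close>,
  whereas \<open>square_function_large\<close> makes it large for large \<open>m\<close>.
\<close>
lemma weak_to_strong_imp_small_vector:
  fixes T :: "(nat \<Rightarrow> 'b::euclidean_space) \<Rightarrow> nat \<Rightarrow> 'b"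
  assumes T: "real_linear_on_psummable s T" "weak_to_strong s q \<kappa> C T"
    and s: "1 \<le> s" "s \<le> 2" "2 \<le> q" "0 \<le> C" "0 \<le> \<kappa>" "\<kappa> < q / s" and \<epsilon>: "0 < \<epsilon>"
  shows "\<exists>m::nat. 1 \<le> m \<and> (\<forall>f. (\<forall>i<m. psummable s (f i) \<and> (1 / 2) powr s \<le> psum s (f i)) \<and>
     (\<forall>w. psum s (\<lambda>k. \<Sum>i<m. w i *\<^sub>R f i k) \<le> L2_set w {..<m} powr s) \<longrightarrow>
     (\<exists>w. let x = (\<lambda>k. \<Sum>i<m. w i *\<^sub>R f i k) in
        0 < psum s x \<and> psum q (T x) powr (1 / q) \<le> \<epsilon> * psum s x powr (1 / s)))"
proof -
  define \<rho> where "\<rho> = q / s"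
  have \<rho>: "1 \<le> \<rho>" "0 < \<rho> - \<kappa>" using s by (auto simp: \<rho>_def field_simps)
  define M where "M = 2 + khinchine_const TYPE('b) 4"
  have M: "0 < M" using khinchine_const_pos[of 4, where ?'b='b] by (simp add: M_def)
  define Kq where "Kq = khinchine_const TYPE('b) q"
  have Kq: "0 < Kq" unfolding Kq_def by (rule khinchine_const_pos) (use s in simp)
  define R where "R = Kq * C * (4 * M) powr \<rho> / \<epsilon> powr q"
  have R: "0 \<le> R" using Kq s by (simp add: R_def)
  \<comment> \<open>A value \<open>W > r / 8\<close> gives \<open>W powr (\<rho> - \<kappa>) > R\<close>, and \<open>W \<ge> sqrt m / 8\<close>; hence the choice of \<open>m\<close>.\<close>
  define r where "r = 8 * (R + 1) powr (1 / (\<rho> - \<kappa>))"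
  obtain m :: nat where m: "r\<^sup>2 < real m" using reals_Archimedean2 by blast
  have r0: "0 < r" using R by (simp add: r_def)
  have m1: "1 \<le> m" using m zero_le_power2[of r] by (cases m) auto
  show ?thesis
  proof (intro exI[of _ m] conjI m1 allI impI)
    fix f :: "nat \<Rightarrow> nat \<Rightarrow> 'b"
    assume "(\<forall>i<m. psummable s (f i) \<and> (1 / 2) powr s \<le> psum s (f i)) \<and>
     (\<forall>w. psum s (\<lambda>k. \<Sum>i<m. w i *\<^sub>R f i k) \<le> L2_set w {..<m} powr s)"
    then have ls: "\<And>i. i < m \<Longrightarrow> psummable s (f i)"
      and half: "\<And>i. i < m \<Longrightarrow> (1 / 2) powr s \<le> psum s (f i)"
      and weak: "\<And>w. psum s (\<lambda>k. \<Sum>i<m. w i *\<^sub>R f i k) \<le> L2_set w {..<m} powr s" by auto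
    define F where "F = (\<lambda>k. L2_set (\<lambda>i. norm (f i k)) {..<m})"
    define G where "G = (\<lambda>l. L2_set (\<lambda>i. norm (T (f i) l)) {..<m})"
    define W where "W = (\<Sum>k. F k powr s)"
    have W: "r / 8 < W"
    proof -
      have "r < sqrt (real m)" using m r0 by (intro real_less_rsqrt) auto
      moreover have "sqrt (real m) / 8 \<le> W"
        unfolding W_def F_def by (rule square_function_large[OF s(1,2) m1]) (use ls half in auto)
      ultimately show ?thesis by simp
    qed
    have W0: "0 < W" using W r0 by linarith
    have WR: "R < W powr (\<rho> - \<kappa>)"
    proof -
      have "R + 1 = ((R + 1) powr (1 / (\<rho> - \<kappa>))) powr (\<rho> - \<kappa>)"
        using R \<rho> by (simp add: powr_powr)
      also have "\<dots> \<le> W powr (\<rho> - \<kappa>)" using W \<rho> by (intro powr_mono2) (auto simp: r_def)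
      finally show ?thesis by simp
    qed
    define x where "x = (\<lambda>A k. \<Sum>i<m. signs A i *\<^sub>R f i k)"
    have xR: "x A k = rademacher {..<m} (\<lambda>i. f i k) A" for A k
      by (simp add: x_def rademacher_def)
    have TxR: "T (x A) l = rademacher {..<m} (\<lambda>i. T (f i) l) A" for A l
      unfolding x_def using real_linearD[OF T(1), of m f "signs A"] ls by (simp add: rademacher_def)
    have xs: "psummable s (x A)" for A
      unfolding x_def by (rule psummable_combination) (use ls s in auto)
    have Txs: "psummable q (T (x A))" for A
      by (rule weak_to_strong_imp_bounded(1)[OF T _ _ _ _ xs]) (use s in auto)
    define a where "a = (\<lambda>A. psum s (x A))"
    define b where "b = (\<lambda>A. psum q (T (x A)))"
    have a0: "0 \<le> a A" and b0: "0 \<le> b A" for A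
      unfolding a_def b_def by (rule psum_nonneg, rule xs Txs)+
    have lower: "2 ^ m * W \<le> 2 * M * (\<Sum>A\<in>Pow {..<m}. a A)"
    proof -
      have smF: "summable (\<lambda>k. F k powr s)"
        unfolding F_def by (rule square_function_summable) (use s ls in auto)
      have smx: "summable (\<lambda>k. norm (x A k) powr s)" for A
        using xs[of A] by (simp add: psummable_def)
      have "2 ^ m * F k powr s \<le> 2 * M * (\<Sum>A\<in>Pow {..<m}. norm (x A k) powr s)" for k
        using khinchine_lower[of "{..<m}" s "\<lambda>i. f i k"] s by (simp add: F_def M_def xR)
      then have "(\<Sum>k. 2 ^ m * F k powr s) \<le> (\<Sum>k. 2 * M * (\<Sum>A\<in>Pow {..<m}. norm (x A k) powr s))"
        by (intro suminf_le summable_mult summable_sum smF smx)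
      also have "\<dots> = 2 * M * (\<Sum>A\<in>Pow {..<m}. a A)"
        unfolding a_def psum_def
        by (subst suminf_mult) (auto intro!: summable_sum smx suminf_sum)
      finally show ?thesis unfolding W_def using suminf_mult[OF smF, of "2 ^ m"] by simp
    qed
    have upper: "(\<Sum>A\<in>Pow {..<m}. b A) \<le> 2 ^ m * (Kq * (C * W powr \<kappa>))"
    proof -
      have smT: "summable (\<lambda>l. norm (T (x A) l) powr q)" for A
        using Txs[of A] by (simp add: psummable_def)
      have "(\<Sum>A\<in>Pow {..<m}. b A) = (\<Sum>l. \<Sum>A\<in>Pow {..<m}. norm (T (x A) l) powr q)"
        unfolding b_def psum_def by (rule suminf_sum[symmetric]) (rule smT)
      also have "\<dots> \<le> 2 ^ m * (Kq * (C * W powr \<kappa>))"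
      proof (rule suminf_le_const)
        show "summable (\<lambda>l. \<Sum>A\<in>Pow {..<m}. norm (T (x A) l) powr q)"
          by (intro summable_sum smT)
        fix K
        have "(\<Sum>l<K. \<Sum>A\<in>Pow {..<m}. norm (T (x A) l) powr q) \<le> (\<Sum>l<K. 2 ^ m * (Kq * G l powr q))"
          using khinchine_upper[of "{..<m}" q "\<lambda>i. T (f i) _"] s
          by (intro sum_mono) (auto simp: TxR Kq_def G_def)
        also have "\<dots> = 2 ^ m * (Kq * (\<Sum>l<K. G l powr q))" by (simp add: sum_distrib_left)
        also have "(\<Sum>l<K. G l powr q) \<le> C * W powr \<kappa>"
          using T(2)[unfolded weak_to_strong_def, rule_format, of m f K] ls weak
          unfolding G_def W_def F_def by blast
        finally show "(\<Sum>l<K. \<Sum>A\<in>Pow {..<m}. norm (T (x A) l) powr q) \<le> 2 ^ m * (Kq * (C * W powr \<kappa>))"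
          using Kq by (simp add: mult_left_mono)
      qed
      finally show ?thesis .
    qed
    have "\<exists>A. 0 < a A \<and> b A powr (1 / q) \<le> \<epsilon> * a A powr (1 / s)"
    proof (rule ccontr)
      assume no: "\<not> ?thesis"
      \<comment> \<open>The average of \<open>a\<close> over all signs is at least \<open>2 * t\<close>, so that \<open>a - t\<close> is still at
        least \<open>t\<close> on average.\<close>
      define t where "t = W / (4 * M)"
      have t: "0 < t" using W0 M by (simp add: t_def)
      have "\<epsilon> powr q * (t powr (\<rho> - 1) * (a A - t)) \<le> b A" for A
      proof (cases "a A = 0")
        case True
        have "\<epsilon> powr q * (t powr (\<rho> - 1) * (a A - t)) \<le> 0"
          using True t by (intro mult_nonneg_nonpos) auto
        then show ?thesis using b0[of A] by linarith
      next
        case False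
        then have "0 < a A" using a0[of A] by linarith
        then have "\<epsilon> * a A powr (1 / s) \<le> b A powr (1 / q)" using no by force
        then have "(\<epsilon> * a A powr (1 / s)) powr q \<le> (b A powr (1 / q)) powr q"
          using s \<epsilon> by (intro powr_mono2) auto
        then have "\<epsilon> powr q * a A powr \<rho> \<le> b A"
          using s \<epsilon> b0[of A] by (simp add: powr_mult powr_powr \<rho>_def)
        moreover have "\<epsilon> powr q * (t powr (\<rho> - 1) * (a A - t)) \<le> \<epsilon> powr q * a A powr \<rho>"
          by (intro mult_left_mono powr_tangent_le a0 t \<rho>) auto
        ultimately show ?thesis by linarith
      qed
      then have "(\<Sum>A\<in>Pow {..<m}. \<epsilon> powr q * (t powr (\<rho> - 1) * (a A - t))) \<le> (\<Sum>A\<in>Pow {..<m}. b A)"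
        by (intro sum_mono)
      also have "(\<Sum>A\<in>Pow {..<m}. \<epsilon> powr q * (t powr (\<rho> - 1) * (a A - t)))
          = \<epsilon> powr q * (t powr (\<rho> - 1) * ((\<Sum>A\<in>Pow {..<m}. a A) - 2 ^ m * t))"
        by (simp add: sum_distrib_left[symmetric] sum_subtractf card_Pow)
      finally have 1: "\<epsilon> powr q * (t powr (\<rho> - 1) * ((\<Sum>A\<in>Pow {..<m}. a A) - 2 ^ m * t))
          \<le> 2 ^ m * (Kq * (C * W powr \<kappa>))" using upper by linarith
      have "2 ^ m * t \<le> (\<Sum>A\<in>Pow {..<m}. a A) - 2 ^ m * t"
        using lower M by (simp add: t_def field_simps)
      then have "\<epsilon> powr q * (t powr (\<rho> - 1) * (2 ^ m * t))
          \<le> \<epsilon> powr q * (t powr (\<rho> - 1) * ((\<Sum>A\<in>Pow {..<m}. a A) - 2 ^ m * t))"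
        by (intro mult_left_mono) auto
      then have 2: "\<epsilon> powr q * (t powr (\<rho> - 1) * (2 ^ m * t)) \<le> 2 ^ m * (Kq * (C * W powr \<kappa>))"
        using 1 by (rule order_trans)
      have "t powr (\<rho> - 1) * t = t powr \<rho>" using t by (simp add: powr_diff)
      then have eq: "\<epsilon> powr q * (t powr (\<rho> - 1) * (2 ^ m * t)) = 2 ^ m * (\<epsilon> powr q * t powr \<rho>)"
        by (metis mult.assoc mult.left_commute)
      have "2 ^ m * (\<epsilon> powr q * t powr \<rho>) \<le> 2 ^ m * (Kq * (C * W powr \<kappa>))"
        using 2 unfolding eq .
      then have "\<epsilon> powr q * t powr \<rho> \<le> Kq * (C * W powr \<kappa>)"
        by (subst (asm) mult_le_cancel_left_pos) auto
      then have "\<epsilon> powr q * (W powr \<rho> / (4 * M) powr \<rho>) \<le> Kq * (C * W powr \<kappa>)"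
        using W0 M by (simp add: t_def powr_divide)
      then have "W powr \<rho> \<le> R * W powr \<kappa>"
        using M \<epsilon> by (simp add: R_def field_simps)
      then have "W powr (\<rho> - \<kappa>) \<le> R" using W0 by (simp add: powr_diff divide_le_eq)
      then show False using WR by simp
    qed
    then obtain A where "0 < a A" "b A powr (1 / q) \<le> \<epsilon> * a A powr (1 / s)" by blast
    then show "\<exists>w. let x = (\<lambda>k. \<Sum>i<m. w i *\<^sub>R f i k) in
        0 < psum s x \<and> psum q (T x) powr (1 / q) \<le> \<epsilon> * psum s x powr (1 / s)"
      by (intro exI[of _ "signs A"]) (simp add: Let_def a_def b_def x_def)
  qed
qed

lemma weak_to_strong_imp_fss:
  fixes T :: "(nat \<Rightarrow> 'a::{real_normed_field, euclidean_space}) \<Rightarrow> nat \<Rightarrow> 'a"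
  assumes T: "real_linear_on_psummable s T" "weak_to_strong s q \<kappa> C T"
    and s: "1 \<le> s" "s \<le> 2" "2 \<le> q" "0 \<le> C" "0 \<le> \<kappa>" "\<kappa> < q / s" and \<epsilon>: "0 < \<epsilon>"
  shows "\<exists>n\<ge>1. \<forall>E. seq.subspace E \<and> seq.dim E = n \<and> (\<forall>x\<in>E. psummable s x) \<longrightarrow>
     (\<exists>x\<in>E. 0 < psum s x \<and> psum q (T x) powr (1 / q) \<le> \<epsilon> * psum s x powr (1 / s))"
proof -
  obtain m :: nat where m: "\<forall>f. (\<forall>i<m. psummable s (f i) \<and> (1 / 2) powr s \<le> psum s (f i)) \<and>
     (\<forall>w. psum s (\<lambda>k. \<Sum>i<m. w i *\<^sub>R f i k) \<le> L2_set w {..<m} powr s) \<longrightarrow>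
     (\<exists>w. let x = (\<lambda>k. \<Sum>i<m. w i *\<^sub>R f i k) in
        0 < psum s x \<and> psum q (T x) powr (1 / q) \<le> \<epsilon> * psum s x powr (1 / s))"
    using weak_to_strong_imp_small_vector[OF T s \<epsilon>] by blast
  obtain n where n: "1 \<le> n" "\<forall>E::(nat \<Rightarrow> 'a) set.
    seq.subspace E \<and> seq.dim E = n \<and> (\<forall>x\<in>E. psummable s x) \<longrightarrow>
    (\<exists>f. (\<forall>i<m. f i \<in> E) \<and> (\<forall>i<m. (1 / 2) powr s \<le> psum s (f i)) \<and>
      (\<forall>w. psum s (\<lambda>k. \<Sum>i<m. w i *\<^sub>R f i k) \<le> L2_set w {..<m} powr s))"
    using hilbertian_system[OF s(1), of m] by blast
  show ?thesis
  proof (intro exI[of _ n] conjI n(1) allI impI)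
    fix E :: "(nat \<Rightarrow> 'a) set"
    assume E: "seq.subspace E \<and> seq.dim E = n \<and> (\<forall>x\<in>E. psummable s x)"
    then obtain f where f: "\<forall>i<m. f i \<in> E" "\<forall>i<m. (1 / 2) powr s \<le> psum s (f i)"
      "\<forall>w. psum s (\<lambda>k. \<Sum>i<m. w i *\<^sub>R f i k) \<le> L2_set w {..<m} powr s"
      using n(2) by blast
    have "\<forall>i<m. psummable s (f i) \<and> (1 / 2) powr s \<le> psum s (f i)" using f E by blast
    then obtain w where w: "0 < psum s (\<lambda>k. \<Sum>i<m. w i *\<^sub>R f i k)"
      "psum q (T (\<lambda>k. \<Sum>i<m. w i *\<^sub>R f i k)) powr (1 / q)
        \<le> \<epsilon> * psum s (\<lambda>k. \<Sum>i<m. w i *\<^sub>R f i k) powr (1 / s)"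
      using m f(3) unfolding Let_def by blast
    have "(\<lambda>k. \<Sum>i<m. w i *\<^sub>R f i k) \<in> E"
      unfolding scaleR_conv_of_real
      by (rule seq_subspace_sum) (use E f in auto)
    then show "\<exists>x\<in>E. 0 < psum s x \<and> psum q (T x) powr (1 / q) \<le> \<epsilon> * psum s x powr (1 / s)"
      using w by blast
  qed
qed

section \<open>Interpolation from Parseval's identity\<close>

text \<open>
  Both sides are integrals of the sums in the last hypothesis with respect to the measure with density \<open>a t\<^sup>a\<^sup>-\<^sup>1\<close>,
  by the layer cake formula.
\<close>
lemma layer_cake_mono:
  fixes y u :: "'i \<Rightarrow> real" and \<tau> v :: "'j \<Rightarrow> real"
  assumes fin: "finite L" "finite K" and a: "0 < a"
    and nn: "\<And>l. l \<in> L \<Longrightarrow> 0 \<le> y l" "\<And>k. k \<in> K \<Longrightarrow> 0 \<le> \<tau> k"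
    and le: "\<And>t. 0 < t \<Longrightarrow> (\<Sum>l\<in>L. if t \<le> y l then u l else 0) \<le> (\<Sum>k\<in>K. if t \<le> \<tau> k then v k else 0)"
  shows "(\<Sum>l\<in>L. u l * y l powr a) \<le> (\<Sum>k\<in>K. v k * \<tau> k powr a)"
proof -
  define B where "B = (\<Sum>l\<in>L. y l) + (\<Sum>k\<in>K. \<tau> k)"
  have sums: "0 \<le> (\<Sum>l\<in>L. y l)" "0 \<le> (\<Sum>k\<in>K. \<tau> k)" using nn by (auto intro: sum_nonneg)
  have lB: "y l \<le> B" if "l \<in> L" for l
    using member_le_sum[of l L y] that nn fin sums unfolding B_def by auto
  have tB: "\<tau> k \<le> B" if "k \<in> K" for k
    using member_le_sum[of k K \<tau>] that nn fin sums unfolding B_def by auto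
  have int: "((\<lambda>t. c * (if t \<in> {0..x} then t powr (a - 1) else 0)) has_integral c * (x powr a / a)) {0..B}"
    if "0 \<le> x" "x \<le> B" for x c
  proof -
    have "((\<lambda>t. t powr (a - 1)) has_integral (x powr (a - 1 + 1) / (a - 1 + 1))) {0..x}"
      by (rule has_integral_powr_from_0) (use a that in auto)
    moreover have "{0..x} \<subseteq> {0..B}" using that by auto
    ultimately have "((\<lambda>t. if t \<in> {0..x} then t powr (a - 1) else 0) has_integral (x powr a / a)) {0..B}"
      by (subst has_integral_restrict) auto
    then show ?thesis by (rule has_integral_mult_right)
  qed
  have "((\<lambda>t. \<Sum>l\<in>L. u l * (if t \<in> {0..y l} then t powr (a - 1) else 0))
      has_integral (\<Sum>l\<in>L. u l * (y l powr a / a))) {0..B}"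
    by (intro has_integral_sum int fin nn lB)
  moreover have "((\<lambda>t. \<Sum>k\<in>K. v k * (if t \<in> {0..\<tau> k} then t powr (a - 1) else 0))
      has_integral (\<Sum>k\<in>K. v k * (\<tau> k powr a / a))) {0..B}"
    by (intro has_integral_sum int fin nn tB)
  ultimately have "(\<Sum>l\<in>L. u l * (y l powr a / a)) \<le> (\<Sum>k\<in>K. v k * (\<tau> k powr a / a))"
  proof (rule has_integral_le)
    fix t assume t: "t \<in> {0..B}"
    show "(\<Sum>l\<in>L. u l * (if t \<in> {0..y l} then t powr (a - 1) else 0))
      \<le> (\<Sum>k\<in>K. v k * (if t \<in> {0..\<tau> k} then t powr (a - 1) else 0))"
    proof (cases "t = 0")
      case False
      then have t0: "0 < t" using t by simp
      have "(\<Sum>l\<in>L. u l * (if t \<in> {0..y l} then t powr (a - 1) else 0))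
          = t powr (a - 1) * (\<Sum>l\<in>L. if t \<le> y l then u l else 0)"
        unfolding sum_distrib_left using t0 by (intro sum.cong) auto
      also have "\<dots> \<le> t powr (a - 1) * (\<Sum>k\<in>K. if t \<le> \<tau> k then v k else 0)"
        by (intro mult_left_mono le t0) auto
      also have "\<dots> = (\<Sum>k\<in>K. v k * (if t \<in> {0..\<tau> k} then t powr (a - 1) else 0))"
        unfolding sum_distrib_left using t0 by (intro sum.cong) auto
      finally show ?thesis .
    next
      case True
      show ?thesis unfolding True by (simp cong: if_cong)
    qed
  qed
  then have "(\<Sum>l\<in>L. u l * y l powr a) / a \<le> (\<Sum>k\<in>K. v k * \<tau> k powr a) / a"
    by (simp add: sum_divide_distrib)
  then show ?thesis using a by (simp add: divide_le_cancel)
qed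

lemma L2_set_sum_sq:
  assumes "finite L"
  shows "(\<Sum>l\<in>L. (L2_set (\<lambda>i. norm (y i l)) I)\<^sup>2) = (\<Sum>i\<in>I. \<Sum>l\<in>L. (norm (y i l))\<^sup>2)"
  unfolding L2_set_def by (subst sum.swap) (simp add: sum_nonneg)

text \<open>
  This is the Marcinkiewicz argument, with the cut at level \<open>t\<close> prescribed by thresholds \<open>\<tau> k\<close>. Let \<open>Lam l\<close> be
  the length of the transformed tuple at \<open>l\<close>. The entries with \<open>\<tau> k < t\<close> contribute at most \<open>t / 2\<close> to it, so
  where \<open>t \<le> Lam l\<close> the entries with \<open>t \<le> \<tau> k\<close> produce at least half of \<open>Lam l\<close>. Parseval's identity for these
  entries yields the distributional inequality that \<open>layer_cake_mono\<close> integrates against \<open>t\<^sup>r\<^sup>-\<^sup>3\<close>.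
\<close>
lemma parseval_imp_interpolation:
  fixes h :: "nat \<Rightarrow> nat \<Rightarrow> 'a::{real_normed_field, euclidean_space}" and f :: "nat \<Rightarrow> nat \<Rightarrow> 'a"
  assumes parseval: "\<And>y. (\<Sum>l<N. (norm (\<Sum>k<N. h l k * y k))\<^sup>2) = real N * (\<Sum>k<N. (norm (y k))\<^sup>2)"
    and \<tau>: "\<And>k. 0 \<le> \<tau> k" and r: "2 < r"
    and small: "\<And>t l. 0 < t \<Longrightarrow> l < N \<Longrightarrow>
      L2_set (\<lambda>i. norm (\<Sum>k<N. h l k * (if \<tau> k < t then f i k else 0))) {..<m} \<le> t / 2"
  shows "(\<Sum>l<N. L2_set (\<lambda>i. norm (\<Sum>k<N. h l k * f i k)) {..<m} powr r)
    \<le> 4 * real N * (\<Sum>k<N. (L2_set (\<lambda>i. norm (f i k)) {..<m})\<^sup>2 * \<tau> k powr (r - 2))"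
proof -
  define Lam where "Lam = (\<lambda>l. L2_set (\<lambda>i. norm (\<Sum>k<N. h l k * f i k)) {..<m})"
  define F where "F = (\<lambda>k. L2_set (\<lambda>i. norm (f i k)) {..<m})"
  have Lam0: "0 \<le> Lam l" for l by (simp add: Lam_def)
  have "(\<Sum>l<N. (Lam l)\<^sup>2 * Lam l powr (r - 2)) \<le> (\<Sum>k<N. (4 * real N * (F k)\<^sup>2) * \<tau> k powr (r - 2))"
  proof (rule layer_cake_mono)
    fix t :: real assume t: "0 < t"
    define lo where "lo = (\<lambda>i k. if \<tau> k < t then f i k else 0)"
    define hi where "hi = (\<lambda>i k. if t \<le> \<tau> k then f i k else 0)"
    define P where "P = (\<lambda>l. L2_set (\<lambda>i. norm (\<Sum>k<N. h l k * hi i k)) {..<m})"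
    have fsplit: "f i k = hi i k + lo i k" for i k by (auto simp: hi_def lo_def)
    have tri: "Lam l \<le> P l + t / 2" if "l < N" for l
    proof -
      have "Lam l \<le> L2_set (\<lambda>i. norm (\<Sum>k<N. h l k * hi i k) + norm (\<Sum>k<N. h l k * lo i k)) {..<m}"
        unfolding Lam_def
        by (intro L2_set_mono) (auto simp: fsplit distrib_left sum.distrib norm_triangle_ineq)
      also have "\<dots> \<le> P l + L2_set (\<lambda>i. norm (\<Sum>k<N. h l k * lo i k)) {..<m}"
        unfolding P_def by (rule L2_set_triangle_ineq)
      also have "\<dots> \<le> P l + t / 2" using small[OF t that] by (simp add: lo_def)
      finally show ?thesis .
    qed
    have "(\<Sum>l<N. if t \<le> Lam l then (Lam l)\<^sup>2 else 0) \<le> (\<Sum>l<N. 4 * (P l)\<^sup>2)"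
    proof (intro sum_mono)
      fix l assume "l \<in> {..<N}"
      then have "Lam l \<le> P l + t / 2" using tri by simp
      then have "(Lam l)\<^sup>2 \<le> (2 * P l)\<^sup>2" if "t \<le> Lam l"
        using that by (intro power_mono Lam0) linarith
      then show "(if t \<le> Lam l then (Lam l)\<^sup>2 else 0) \<le> 4 * (P l)\<^sup>2"
        by (simp add: power_mult_distrib)
    qed
    also have "\<dots> = 4 * (\<Sum>i<m. \<Sum>l<N. (norm (\<Sum>k<N. h l k * hi i k))\<^sup>2)"
      unfolding P_def by (simp add: sum_distrib_left[symmetric] L2_set_sum_sq)
    also have "\<dots> = 4 * (real N * (\<Sum>k<N. (L2_set (\<lambda>i. norm (hi i k)) {..<m})\<^sup>2))"
      by (simp add: parseval L2_set_sum_sq sum_distrib_left)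
    also have "\<dots> = (\<Sum>k<N. if t \<le> \<tau> k then 4 * real N * (F k)\<^sup>2 else 0)"
      unfolding sum_distrib_left by (intro sum.cong refl) (auto simp: F_def hi_def L2_set_def)
    finally show "(\<Sum>l<N. if t \<le> Lam l then (Lam l)\<^sup>2 else 0)
      \<le> (\<Sum>k<N. if t \<le> \<tau> k then 4 * real N * (F k)\<^sup>2 else 0)" .
  qed (use r \<tau> Lam0 in auto)
  moreover have "(Lam l)\<^sup>2 * Lam l powr (r - 2) = Lam l powr r" for l
  proof (cases "Lam l = 0")
    case False
    then have "0 < Lam l" using Lam0[of l] by linarith
    then have "(Lam l)\<^sup>2 = Lam l powr 2" by simp
    then show ?thesis by (simp add: powr_add[symmetric])
  qed (use r in simp)
  ultimately show ?thesis by (simp add: Lam_def F_def sum_distrib_left mult.assoc)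
qed

section \<open>The Hadamard matrices and the block structure\<close>

lemma sum_lessThan_split: "(\<Sum>i<m + n. g i) = (\<Sum>i<m. g i) + (\<Sum>i<n. g (m + i))"
  for g :: "nat \<Rightarrow> 'b::comm_monoid_add"
  by (induction n) (auto simp: add.assoc)

abbreviation had :: "nat \<Rightarrow> nat \<Rightarrow> nat \<Rightarrow> 'a::comm_ring_1" where
  "had n l k \<equiv> hadamard n $$ (l, k)"

lemma hadamard_dims [simp]: "dim_row (hadamard n) = 2 ^ n" "dim_col (hadamard n) = 2 ^ n"
  using hadamard_carrier[of n] by auto

lemma had_Suc:
  assumes "l < 2 ^ n" "k < 2 ^ n"
  shows "had (Suc n) l k = (had n l k :: 'a::comm_ring_1)"
    "had (Suc n) l (2 ^ n + k) = (had n l k :: 'a)"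
    "had (Suc n) (2 ^ n + l) k = (had n l k :: 'a)"
    "had (Suc n) (2 ^ n + l) (2 ^ n + k) = (- had n l k :: 'a)"
  using assms by auto

lemma norm_had: "l < 2 ^ n \<Longrightarrow> k < 2 ^ n \<Longrightarrow> norm (had n l k :: 'a::real_normed_field) = 1"
proof (induction n arbitrary: l k)
  case 0
  then show ?case by simp
next
  case (Suc n)
  have *: "\<exists>l'<2 ^ n. l = l' \<or> l = 2 ^ n + l'" if "l < 2 ^ Suc n" for l :: nat
    using that by (cases "l < 2 ^ n") (auto intro: exI[of _ "l - 2 ^ n"])
  obtain l' k' where "l' < 2 ^ n" "l = l' \<or> l = 2 ^ n + l'" "k' < 2 ^ n" "k = k' \<or> k = 2 ^ n + k'"
    using *[OF Suc.prems(1)] *[OF Suc.prems(2)] by blast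
  then show ?case using Suc.IH[of l' k'] had_Suc[of l' n k', where ?'a='a] by auto
qed

text \<open>
  The two halves of the transform of \<open>x\<close> are \<open>y + z\<close> and \<open>y - z\<close>, where \<open>y\<close> and \<open>z\<close> are the transforms of the two
  halves of \<open>x\<close>; the parallelogram law then gives the factor \<open>2\<close> of each step.
\<close>
lemma hadamard_parseval:
  fixes x :: "nat \<Rightarrow> 'a::{real_normed_field, real_inner}"
  shows "(\<Sum>l<2 ^ n. (norm (\<Sum>k<2 ^ n. had n l k * x k))\<^sup>2) = real (2 ^ n) * (\<Sum>k<2 ^ n. (norm (x k))\<^sup>2)"
proof (induction n arbitrary: x)
  case 0
  then show ?case by simp
next
  case (Suc n)
  define y where "y = (\<lambda>l. \<Sum>k<2 ^ n. had n l k * x k)"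
  define z where "z = (\<lambda>l. \<Sum>k<2 ^ n. had n l k * x (2 ^ n + k))"
  have dbl: "(2::nat) ^ Suc n = 2 ^ n + 2 ^ n" by simp
  have up: "(\<Sum>k<2 ^ Suc n. had (Suc n) l k * x k) = y l + z l" if "l < 2 ^ n" for l
    unfolding dbl sum_lessThan_split y_def z_def
    using that by (intro arg_cong2[of _ _ _ _ "(+)"] sum.cong) (auto simp del: hadamard.simps simp: had_Suc)
  have lo: "(\<Sum>k<2 ^ Suc n. had (Suc n) (2 ^ n + l) k * x k) = y l - z l" if "l < 2 ^ n" for l
    unfolding dbl sum_lessThan_split y_def z_def diff_conv_add_uminus sum_negf[symmetric]
    using that by (intro arg_cong2[of _ _ _ _ "(+)"] sum.cong) (auto simp del: hadamard.simps simp: had_Suc)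
  have "(\<Sum>l<2 ^ Suc n. (norm (\<Sum>k<2 ^ Suc n. had (Suc n) l k * x k))\<^sup>2)
      = (\<Sum>l<2 ^ n. (norm (y l + z l))\<^sup>2) + (\<Sum>l<2 ^ n. (norm (y l - z l))\<^sup>2)"
    by (subst (1) dbl, subst sum_lessThan_split)
      (intro arg_cong2[of _ _ _ _ "(+)"] sum.cong refl; simp add: up lo del: hadamard.simps power_Suc)
  also have "\<dots> = 2 * (\<Sum>l<2 ^ n. (norm (y l))\<^sup>2) + 2 * (\<Sum>l<2 ^ n. (norm (z l))\<^sup>2)"
    by (simp add: sum.distrib[symmetric] parallelogram_law sum_distrib_left)
  also have "\<dots> = real (2 ^ Suc n) * (\<Sum>k<2 ^ Suc n. (norm (x k))\<^sup>2)"
    unfolding y_def z_def Suc.IH dbl sum_lessThan_split by (simp add: algebra_simps)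
  finally show ?case .
qed

lemma block_decomposition:
  obtains n l where "1 \<le> n" "l < 2 ^ n" "i = block_start n + l"
proof -
  have "\<exists>n l. 1 \<le> n \<and> l < 2 ^ n \<and> i = block_start n + l"
  proof (induction i)
    case 0
    show ?case by (rule exI[of _ 1], rule exI[of _ 0]) (simp add: block_start_def)
  next
    case (Suc i)
    then obtain n l where nl: "1 \<le> n" "l < 2 ^ n" "i = block_start n + l" by blast
    show ?case
    proof (cases "Suc l < 2 ^ n")
      case True
      then show ?thesis using nl by (intro exI[of _ n] exI[of _ "Suc l"]) auto
    next
      case False
      then have "Suc l = 2 ^ n" using nl by linarith
      then show ?thesis using nl block_start_Suc[OF nl(1)]
        by (intro exI[of _ "Suc n"] exI[of _ 0]) auto
    qed
  qed
  then show ?thesis using that by blast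
qed

lemma sum_blocks:
  fixes g :: "nat \<Rightarrow> 'b::comm_monoid_add"
  shows "(\<Sum>i<block_start (Suc M). g i) = (\<Sum>n=1..M. \<Sum>l<2 ^ n. g (block_start n + l))"
proof (induction M)
  case 0
  show ?case by (simp add: block_start_def)
next
  case (Suc M)
  have "block_start (Suc (Suc M)) = block_start (Suc M) + 2 ^ Suc M" by (rule block_start_Suc) simp
  then show ?case by (simp only: sum_lessThan_split Suc.IH) simp
qed

lemma le_block_start_Suc: "M \<le> block_start (Suc M)"
proof (induction M)
  case (Suc M)
  have "block_start (Suc (Suc M)) = block_start (Suc M) + 2 ^ Suc M" by (rule block_start_Suc) simp
  moreover have "(1::nat) \<le> 2 ^ Suc M" by simp
  ultimately show ?case using Suc by linarith
qed simp

text \<open>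
  Estimates which hold blockwise with one constant add up, since every initial segment is covered by an
  initial segment of blocks.
\<close>
lemma sum_le_of_blocks:
  fixes g h :: "nat \<Rightarrow> real"
  assumes g: "\<And>i. 0 \<le> g i" and h: "\<And>i. 0 \<le> h i" "summable h" and D: "0 \<le> D"
    and le: "\<And>n. 1 \<le> n \<Longrightarrow> (\<Sum>l<2 ^ n. g (block_start n + l)) \<le> D * (\<Sum>k<2 ^ n. h (block_start n + k))"
  shows "(\<Sum>l<K. g l) \<le> D * (\<Sum>k. h k)"
proof -
  have "(\<Sum>l<K. g l) \<le> (\<Sum>l<block_start (Suc K). g l)"
    using le_block_start_Suc[of K] g by (intro sum_mono2) auto
  also have "\<dots> = (\<Sum>n=1..K. \<Sum>l<2 ^ n. g (block_start n + l))" by (rule sum_blocks)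
  also have "\<dots> \<le> (\<Sum>n=1..K. D * (\<Sum>k<2 ^ n. h (block_start n + k)))"
    by (intro sum_mono le) auto
  also have "\<dots> = D * (\<Sum>k<block_start (Suc K). h k)"
    unfolding sum_blocks sum_distrib_left ..
  also have "\<dots> \<le> D * (\<Sum>k. h k)"
    using h D by (intro mult_left_mono sum_le_suminf) auto
  finally show ?thesis .
qed

text \<open>
  The block operator with an arbitrary normalizing exponent \<open>\<alpha>\<close> in place of \<open>1 / min {p', q}\<close>. It is the same
  operator for all pairs of spaces with the same \<open>\<alpha>\<close>, which permits a change of the exponents.
\<close>
definition had_op :: "real \<Rightarrow> (nat \<Rightarrow> 'a::real_normed_field) \<Rightarrow> nat \<Rightarrow> 'a" where
  "had_op \<alpha> x i = (let n = block_of i in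
     (real (2 ^ n) powr (- \<alpha>)) *\<^sub>R (\<Sum>k<2 ^ n. had n (i - block_start n) k * x (block_start n + k)))"

lemma had_op_block:
  assumes "1 \<le> n" "l < 2 ^ n"
  shows "had_op \<alpha> x (block_start n + l)
    = (real (2 ^ n) powr (- \<alpha>)) *\<^sub>R (\<Sum>k<2 ^ n. had n l k * x (block_start n + k))"
  using assms by (simp add: had_op_def block_of_eq)

lemma block_hadamard_eq_had_op:
  "block_hadamard p q = had_op (enn2real (1 / min (conj_exponent p) q))"
proof (intro ext)
  fix x :: "nat \<Rightarrow> 'a" and i
  obtain n l where nl: "1 \<le> n" "l < 2 ^ n" "i = block_start n + l"
    using block_decomposition by blast
  show "block_hadamard p q x i = had_op (enn2real (1 / min (conj_exponent p) q)) x i"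
    unfolding nl(3) had_op_block[OF nl(1,2)] using nl(1,2)
    by (simp add: block_hadamard_def block_sum_def block_of_eq hadamard_op_def seq_block_def
        scalar_prod_def scaleR_conv_of_real atLeast0LessThan)
qed

lemma had_op_linear: "real_linear_on_psummable s (had_op \<alpha>)"
  unfolding real_linear_on_psummable_def had_op_def Let_def
  by (auto intro!: ext simp: sum_distrib_left scaleR_sum_right mult.left_commute scaleR_conv_of_real
      simp flip: sum_distrib_right intro: sum.swap)

section \<open>Weak-to-strong estimates for the Hadamard operator\<close>

lemma powr_two: "0 \<le> x \<Longrightarrow> x powr 2 = (x::real)\<^sup>2"
  using powr_realpow'[of x 2] by simp

context
  fixes s :: real and m :: nat and f :: "nat \<Rightarrow> nat \<Rightarrow> 'a::{real_normed_field, euclidean_space}"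
  assumes s: "1 \<le> s" and ls: "\<And>i. i < m \<Longrightarrow> psummable s (f i)"
    and weak: "\<And>w. psum s (\<lambda>k. \<Sum>i<m. w i *\<^sub>R f i k) \<le> L2_set w {..<m} powr s"
begin

lemma weak_finite_sum:
  assumes "finite S"
  shows "(\<Sum>k\<in>S. norm (\<Sum>i<m. w i *\<^sub>R f i k) powr s) \<le> L2_set w {..<m} powr s"
proof -
  have "psummable s (\<lambda>k. \<Sum>i<m. w i *\<^sub>R f i k)"
    by (rule psummable_combination) (use ls s in auto)
  then have "(\<Sum>k\<in>S. norm (\<Sum>i<m. w i *\<^sub>R f i k) powr s) \<le> psum s (\<lambda>k. \<Sum>i<m. w i *\<^sub>R f i k)"
    unfolding psum_def psummable_def by (rule sum_le_suminf) (use assms in auto)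
  then show ?thesis using weak[of w] by linarith
qed

lemma weak_pointwise: "norm (\<Sum>i<m. w i *\<^sub>R f i k) \<le> L2_set w {..<m}"
proof (rule ccontr)
  assume "\<not> ?thesis"
  then have "L2_set w {..<m} powr s < norm (\<Sum>i<m. w i *\<^sub>R f i k) powr s"
    using s by (intro powr_less_mono2) auto
  then show False using weak_finite_sum[of "{k}" w] by simp
qed

lemma square_function_le_dim: "L2_set (\<lambda>i. norm (f i k)) {..<m} \<le> real DIM('a)"
  using L2_set_le_of_dual_bound[of "{..<m}" 1 "\<lambda>i. f i k"] weak_pointwise by simp

text \<open>
  Hoelder's inequality with the exponents \<open>r\<close> and \<open>s\<close>, which are conjugate; \<open>F powr (1 / (r - 1))\<close> is \<open>F powr (s - 1)\<close>,
  whose \<open>r\<close>-th power is \<open>F powr s\<close>. It is derived from Young's inequality for the normalized factors.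
\<close>
lemma weak_holder:
  assumes r: "1 < r" and sr: "s = r / (r - 1)" and S: "finite S"
  defines "F \<equiv> \<lambda>k. L2_set (\<lambda>i. norm (f i k)) {..<m}"
  shows "(\<Sum>k\<in>S. F k powr (1 / (r - 1)) * norm (\<Sum>i<m. w i *\<^sub>R f i k))
    \<le> (\<Sum>k. F k powr s) powr (1 / r) * L2_set w {..<m}"
proof -
  define W where "W = (\<Sum>k. F k powr s)"
  define g where "g = (\<lambda>k. norm (\<Sum>i<m. w i *\<^sub>R f i k))"
  define V where "V = L2_set w {..<m}"
  have smF: "summable (\<lambda>k. F k powr s)"
    unfolding F_def by (rule square_function_summable) (use s ls in auto)
  have F0: "0 \<le> F k" for k by (simp add: F_def)
  have W0: "0 \<le> W" unfolding W_def by (rule suminf_nonneg[OF smF]) simp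
  have WS: "(\<Sum>k\<in>S. F k powr s) \<le> W"
    unfolding W_def by (rule sum_le_suminf[OF smF S]) simp
  have V0: "0 \<le> V" by (simp add: V_def)
  show ?thesis
  proof (cases "W = 0 \<or> V = 0")
    case True
    have zero: "F k powr (1 / (r - 1)) * g k = 0" for k
    proof (cases "V = 0")
      case True
      then have "g k \<le> 0" using weak_pointwise[of w k] by (simp add: g_def V_def)
      then show ?thesis by (simp add: g_def)
    next
      case False
      then have "F k powr s = 0"
        using True suminf_eq_zero_iff[OF smF] unfolding W_def by simp
      then show ?thesis by simp
    qed
    have "(\<Sum>k\<in>S. F k powr (1 / (r - 1)) * g k) = 0" by (intro sum.neutral ballI zero)
    then show ?thesis using V0 unfolding g_def V_def by simp
  next
    case False
    then have pos: "0 < W" "0 < V" using W0 V0 by auto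
    define c where "c = W powr (1 / r)"
    have c: "0 < c" using pos by (simp add: c_def)
    have s1: "1 < s" using r by (simp add: sr)
    have conj: "1 / r + 1 / s = 1" using r by (simp add: sr field_simps)
    have "F k powr (1 / (r - 1)) / c * (g k / V) \<le> F k powr s / W / r + g k powr s / V powr s / s" for k
    proof -
      have "(F k powr (1 / (r - 1)) / c) powr r = F k powr s / W"
        using pos c r F0 by (simp add: powr_divide powr_powr c_def sr)
      moreover have "(g k / V) powr s = g k powr s / V powr s"
        using pos by (simp add: powr_divide g_def)
      ultimately show ?thesis
        using Youngs_inequality[OF r s1 conj, of "F k powr (1 / (r - 1)) / c" "g k / V"] c pos
        by (simp add: g_def)
    qed
    then have "(\<Sum>k\<in>S. F k powr (1 / (r - 1)) / c * (g k / V))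
        \<le> (\<Sum>k\<in>S. F k powr s / W / r + g k powr s / V powr s / s)" by (rule sum_mono)
    also have "\<dots> = (\<Sum>k\<in>S. F k powr s) / W / r + (\<Sum>k\<in>S. g k powr s) / V powr s / s"
      by (simp add: sum.distrib sum_divide_distrib)
    also have "\<dots> \<le> 1 / r + 1 / s"
    proof (intro add_mono divide_right_mono)
      show "(\<Sum>k\<in>S. F k powr s) / W \<le> 1" using WS pos by simp
      show "(\<Sum>k\<in>S. g k powr s) / V powr s \<le> 1"
        using weak_finite_sum[OF S, of w] pos by (simp add: g_def V_def)
    qed (use r s in auto)
    finally have "(\<Sum>k\<in>S. F k powr (1 / (r - 1)) * g k) / (c * V) \<le> 1"
      unfolding conj by (simp add: sum_divide_distrib)
    then show ?thesis using c pos by (simp add: c_def W_def V_def g_def divide_le_eq)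
  qed
qed

end

text \<open>
  The thresholds are \<open>\<tau> k = B F(k)\<^sup>1\<^sup>-\<^sup>s\<close>, where \<open>s - 1 = 1 / (r - 1)\<close>. If \<open>\<tau> k < t\<close>, then \<open>1\<close> is at most
  \<open>t / B\<close> times \<open>F(k)\<^sup>s\<^sup>-\<^sup>1\<close>. The entries of the Hadamard matrix have absolute value \<open>1\<close>, so \<open>weak_holder\<close> bounds the
  transform of the entries with \<open>\<tau> k < t\<close>, tested against a unit vector, by \<open>t / B\<close> times the \<open>1/r\<close>-th power of
  \<open>W = \<Sum>\<^sub>k F(k)\<^sup>s\<close>; the choice of \<open>B\<close> as a multiple of that power makes this the required fraction of \<open>t\<close>.
  In the bound of \<open>parseval_imp_interpolation\<close>, \<open>F(k)\<^sup>2\<close> and the power \<open>r - 2\<close> of \<open>F(k)\<^sup>1\<^sup>-\<^sup>s\<close>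
  combine to \<open>F(k)\<^sup>s\<close>. So each block contributes its part of \<open>W\<close>, with a factor \<open>B powr (r - 2)\<close>, which is a
  power \<open>1 - 2 / r\<close> of \<open>W\<close>.
\<close>
lemma weak_to_strong_dual_exponents:
  assumes r: "2 < r"
  shows "weak_to_strong (r / (r - 1)) r (2 - 2 / r) (4 * (2 * real DIM('a)) powr (r - 2))
    (had_op (1 / r) :: (nat \<Rightarrow> 'a::{real_normed_field, euclidean_space}) \<Rightarrow> nat \<Rightarrow> 'a)"
  unfolding weak_to_strong_def
proof (intro allI impI)
  fix m :: nat and f :: "nat \<Rightarrow> nat \<Rightarrow> 'a" and K :: nat
  define s where "s = r / (r - 1)"
  have s1: "1 < s" using r by (simp add: s_def)
  assume "(\<forall>i<m. psummable (r / (r - 1)) (f i)) \<and>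
     (\<forall>w. psum (r / (r - 1)) (\<lambda>k. \<Sum>i<m. w i *\<^sub>R f i k) \<le> L2_set w {..<m} powr (r / (r - 1)))"
  then have ls: "\<And>i. i < m \<Longrightarrow> psummable s (f i)"
    and weak: "\<And>w. psum s (\<lambda>k. \<Sum>i<m. w i *\<^sub>R f i k) \<le> L2_set w {..<m} powr s"
    by (auto simp: s_def)
  define d where "d = real DIM('a)"
  have d: "1 \<le> d" by (simp add: d_def Suc_le_eq)
  define F where "F = (\<lambda>k. L2_set (\<lambda>i. norm (f i k)) {..<m})"
  define G where "G = (\<lambda>l. L2_set (\<lambda>i. norm (had_op (1 / r) (f i) l)) {..<m})"
  define W where "W = (\<Sum>k. F k powr s)"
  have F0: "0 \<le> F k" for k by (simp add: F_def)
  have smF: "summable (\<lambda>k. F k powr s)"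
    unfolding F_def by (rule square_function_summable) (use s1 ls in auto)
  have W0: "0 \<le> W" unfolding W_def by (rule suminf_nonneg[OF smF]) simp
  \<comment> \<open>The factor \<open>2\<close> yields \<open>t / 2\<close>, and \<open>d\<close> compensates the loss in \<open>L2_set_le_of_dual_bound\<close>.\<close>
  define B where "B = 2 * d * W powr (1 / r)"
  have B0: "0 \<le> B" using d by (simp add: B_def)
  define \<tau> where "\<tau> = (\<lambda>k. B * F k powr (- (1 / (r - 1))))"
  have small: "L2_set (\<lambda>i. norm (\<Sum>k<2 ^ n. had n l k *
      (if \<tau> (block_start n + k) < t then f i (block_start n + k) else 0))) {..<m} \<le> t / 2"
    if t: "0 < t" and l: "l < 2 ^ n" for t n l
  proof -
    define S where "S = {k. k < 2 ^ n \<and> \<tau> (block_start n + k) < t}"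
    define g where "g = (\<lambda>w k. norm (\<Sum>i<m. w i *\<^sub>R f i k))"
    have eq: "(\<Sum>k<2 ^ n. had n l k * (if \<tau> (block_start n + k) < t then f i (block_start n + k) else 0))
        = (\<Sum>k\<in>S. had n l k * f i (block_start n + k))" for i
      unfolding S_def by (rule sum.mono_neutral_cong_right) auto
    have finS: "finite S" by (simp add: S_def)
    have triangle: "norm (\<Sum>i<m. w i *\<^sub>R (\<Sum>k\<in>S. had n l k * f i (block_start n + k)))
        \<le> (\<Sum>k\<in>S. g w (block_start n + k))" for w
    proof -
      have "(\<Sum>i<m. w i *\<^sub>R (\<Sum>k\<in>S. had n l k * f i (block_start n + k)))
          = (\<Sum>k\<in>S. had n l k * (\<Sum>i<m. w i *\<^sub>R f i (block_start n + k)))"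
        unfolding scaleR_sum_right sum_distrib_left by (subst sum.swap) simp
      also have "norm \<dots> \<le> (\<Sum>k\<in>S. g w (block_start n + k))"
        using l by (intro sum_norm_le) (auto simp: norm_mult norm_had S_def g_def)
      finally show ?thesis .
    qed
    have F_zero: "g w k = 0" if "F k = 0" for w k
    proof -
      have "\<forall>i<m. f i k = 0" using that unfolding F_def by (subst (asm) L2_set_eq_0_iff) auto
      then show ?thesis by (simp add: g_def)
    qed
    show ?thesis
    proof (cases "W = 0")
      case True
      then have "F k = 0" for k
        using suminf_eq_zero_iff[OF smF] unfolding W_def by simp
      then have f0: "\<forall>i<m. f i k = 0" for k
        unfolding F_def by (subst (asm) L2_set_eq_0_iff) auto
      show ?thesis
        by (subst L2_set_0') (use t f0 in \<open>auto intro!: sum.neutral\<close>)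
    next
      case False
      then have W: "0 < W" using W0 by simp
      then have B: "0 < B" using d by (simp add: B_def)
      have "norm (\<Sum>i<m. w i *\<^sub>R (\<Sum>k\<in>S. had n l k * f i (block_start n + k)))
          \<le> t / (2 * d) * L2_set w {..<m}" for w
      proof -
        have "B * g w (block_start n + k)
            \<le> t * (F (block_start n + k) powr (1 / (r - 1)) * g w (block_start n + k))" if "k \<in> S" for k
        proof (cases "F (block_start n + k) = 0")
          case False
          then have "0 < F (block_start n + k)" using F0[of "block_start n + k"] by linarith
          then have "B < t * F (block_start n + k) powr (1 / (r - 1))"
            using that by (simp add: S_def \<tau>_def powr_minus field_simps)
          then have "B * g w (block_start n + k)
              \<le> (t * F (block_start n + k) powr (1 / (r - 1))) * g w (block_start n + k)"
            by (intro mult_right_mono) (auto simp: g_def)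
          then show ?thesis by (simp add: mult.assoc)
        qed (simp add: F_zero)
        then have "(\<Sum>k\<in>S. B * g w (block_start n + k))
            \<le> (\<Sum>k\<in>S. t * (F (block_start n + k) powr (1 / (r - 1)) * g w (block_start n + k)))"
          by (rule sum_mono)
        then have "B * (\<Sum>k\<in>S. g w (block_start n + k))
            \<le> t * (\<Sum>k\<in>S. F (block_start n + k) powr (1 / (r - 1)) * g w (block_start n + k))"
          by (simp add: sum_distrib_left)
        also have "(\<Sum>k\<in>S. F (block_start n + k) powr (1 / (r - 1)) * g w (block_start n + k))
            = (\<Sum>k\<in>(+) (block_start n) ` S. F k powr (1 / (r - 1)) * g w k)"
          by (subst sum.reindex) auto
        also have "\<dots> \<le> W powr (1 / r) * L2_set w {..<m}"
          unfolding W_def F_def g_def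
          by (rule weak_holder[OF _ ls weak]) (use s1 r finS s_def in auto)
        finally have "B * (\<Sum>k\<in>S. g w (block_start n + k)) \<le> t * (W powr (1 / r) * L2_set w {..<m})"
          using t by simp
        then have "W powr (1 / r) * (2 * d * (\<Sum>k\<in>S. g w (block_start n + k)))
            \<le> W powr (1 / r) * (t * L2_set w {..<m})"
          by (simp add: B_def mult_ac)
        then have "2 * d * (\<Sum>k\<in>S. g w (block_start n + k)) \<le> t * L2_set w {..<m}"
          using W by (subst (asm) mult_le_cancel_left_pos) auto
        then have "(\<Sum>k\<in>S. g w (block_start n + k)) \<le> t / (2 * d) * L2_set w {..<m}"
          using d by (simp add: field_simps)
        then show ?thesis using triangle[of w] by linarith
      qed
      then have "L2_set (\<lambda>i. norm (\<Sum>k\<in>S. had n l k * f i (block_start n + k))) {..<m}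
          \<le> real DIM('a) * (t / (2 * d))"
        using t d by (intro L2_set_le_of_dual_bound) auto
      then show ?thesis using d by (simp add: eq d_def)
    qed
  qed
  define D where "D = 4 * B powr (r - 2)"
  have block: "(\<Sum>l<2 ^ n. G (block_start n + l) powr r) \<le> D * (\<Sum>k<2 ^ n. F (block_start n + k) powr s)"
    if n: "1 \<le> n" for n
  proof -
    define N where "N = real (2 ^ n)"
    have N: "0 < N" by (simp add: N_def)
    define Lam where "Lam = (\<lambda>l. L2_set (\<lambda>i. norm (\<Sum>k<2 ^ n. had n l k * f i (block_start n + k))) {..<m})"
    have GL: "G (block_start n + l) powr r = Lam l powr r / N" if "l < 2 ^ n" for l
    proof -
      have "G (block_start n + l) = N powr (- (1 / r)) * Lam l"
        unfolding G_def Lam_def N_def by (simp add: had_op_block[OF n that] L2_set_right_distrib)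
      then have "G (block_start n + l) powr r = (N powr (- (1 / r)) * Lam l) powr r" by (simp only:)
      also have "\<dots> = N powr (- 1) * Lam l powr r"
        using r by (subst powr_mult) (auto simp: powr_powr Lam_def)
      also have "\<dots> = Lam l powr r / N" using N by (simp add: powr_minus field_simps)
      finally show ?thesis .
    qed
    have "(\<Sum>l<2 ^ n. Lam l powr r)
        \<le> 4 * real (2 ^ n) * (\<Sum>k<2 ^ n. (F (block_start n + k))\<^sup>2 * \<tau> (block_start n + k) powr (r - 2))"
      unfolding Lam_def F_def
      by (rule parseval_imp_interpolation[OF hadamard_parseval])
        (use small r B0 in \<open>auto simp: \<tau>_def\<close>)
    also have "\<dots> = 4 * N * (\<Sum>k<2 ^ n. B powr (r - 2) * F (block_start n + k) powr s)"
    proof -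
      have "(F k)\<^sup>2 * \<tau> k powr (r - 2) = B powr (r - 2) * F k powr s" for k
      proof (cases "F k = 0")
        case False
        then have Fk: "0 < F k" using F0[of k] by linarith
        have "\<tau> k powr (r - 2) = B powr (r - 2) * F k powr (- (1 / (r - 1)) * (r - 2))"
          using B0 by (simp add: \<tau>_def powr_mult powr_powr)
        moreover have "(F k)\<^sup>2 = F k powr 2" using Fk by simp
        moreover have "F k powr 2 * F k powr (- (1 / (r - 1)) * (r - 2)) = F k powr s"
        proof -
          have "2 + - (1 / (r - 1)) * (r - 2) = s" using r by (simp add: s_def field_simps)
          then show ?thesis by (simp only: powr_add[symmetric])
        qed
        ultimately show ?thesis by (metis mult.left_commute)
      qed (use s1 in simp)
      then show ?thesis by (simp add: N_def)
    qed
    finally have "(\<Sum>l<2 ^ n. Lam l powr r) \<le> N * (D * (\<Sum>k<2 ^ n. F (block_start n + k) powr s))"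
      by (simp add: D_def sum_distrib_left mult_ac)
    moreover have "(\<Sum>l<2 ^ n. G (block_start n + l) powr r) = (\<Sum>l<2 ^ n. Lam l powr r) / N"
      by (simp add: GL sum_divide_distrib)
    ultimately show ?thesis using N by (simp add: divide_le_eq mult.commute)
  qed
  have "(\<Sum>l<K. G l powr r) \<le> D * W"
    unfolding W_def by (rule sum_le_of_blocks) (use block smF in \<open>auto simp: D_def\<close>)
  also have "D * W = 4 * (2 * d) powr (r - 2) * W powr (2 - 2 / r)"
  proof (cases "W = 0")
    case False
    then have W: "0 < W" using W0 by simp
    have "D = 4 * ((2 * d) powr (r - 2) * W powr (1 / r * (r - 2)))"
      using d W by (simp add: D_def B_def powr_mult powr_powr)
    moreover have "W powr (1 / r * (r - 2)) * W = W powr (2 - 2 / r)"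
    proof -
      have eq: "2 - 2 / r = 1 / r * (r - 2) + 1" using r by (simp add: field_simps)
      show ?thesis by (subst eq, subst powr_add) (use W in simp)
    qed
    ultimately show ?thesis by (simp only: mult.assoc)
  qed simp
  finally show "(\<Sum>l<K. L2_set (\<lambda>i. norm (had_op (1 / r) (f i) l)) {..<m} powr r)
    \<le> 4 * (2 * real DIM('a)) powr (r - 2) *
      (\<Sum>k. L2_set (\<lambda>i. norm (f i k)) {..<m} powr (r / (r - 1))) powr (2 - 2 / r)"
    by (simp add: G_def F_def W_def d_def s_def)
qed

lemma had_op_half_isometry_block:
  fixes x :: "nat \<Rightarrow> 'a::{real_normed_field, real_inner}"
  assumes n: "1 \<le> n"
  shows "(\<Sum>l<2 ^ n. (norm (had_op (1 / 2) x (block_start n + l)))\<^sup>2)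
    = (\<Sum>k<2 ^ n. (norm (x (block_start n + k)))\<^sup>2)"
proof -
  define N where "N = real (2 ^ n)"
  have N: "0 < N" by (simp add: N_def)
  have c: "(N powr (- (1 / 2)))\<^sup>2 = 1 / N"
    using N by (simp add: power2_eq_square powr_add[symmetric] powr_minus field_simps)
  have "(\<Sum>l<2 ^ n. (norm (had_op (1 / 2) x (block_start n + l)))\<^sup>2)
      = (\<Sum>l<2 ^ n. (N powr (- (1 / 2)))\<^sup>2 * (norm (\<Sum>k<2 ^ n. had n l k * x (block_start n + k)))\<^sup>2)"
    unfolding N_def by (intro sum.cong refl) (simp add: had_op_block[OF n] power_mult_distrib)
  also have "\<dots> = 1 / N * (N * (\<Sum>k<2 ^ n. (norm (x (block_start n + k)))\<^sup>2))"
    unfolding sum_distrib_left[symmetric] c hadamard_parseval N_def[symmetric] ..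
  finally show ?thesis using N by simp
qed

lemma square_function_half_isometry_block:
  fixes f :: "nat \<Rightarrow> nat \<Rightarrow> 'a::{real_normed_field, real_inner}"
  assumes n: "1 \<le> n"
  shows "(\<Sum>l<2 ^ n. (L2_set (\<lambda>i. norm (had_op (1 / 2) (f i) (block_start n + l))) I)\<^sup>2)
    = (\<Sum>k<2 ^ n. (L2_set (\<lambda>i. norm (f i (block_start n + k))) I)\<^sup>2)"
  using L2_set_sum_sq[of "{..<2 ^ n}" "\<lambda>i l. had_op (1 / 2) (f i) (block_start n + l)" I]
    L2_set_sum_sq[of "{..<2 ^ n}" "\<lambda>i k. f i (block_start n + k)" I]
  by (simp add: had_op_half_isometry_block[OF n])

lemma powr_le_of_bounded:
  fixes x d :: real
  assumes "0 \<le> x" "x \<le> d" "0 < a" "a \<le> b"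
  shows "x powr b \<le> d powr (b - a) * x powr a"
proof (cases "x = 0")
  case False
  then have "x powr b = x powr (b - a) * x powr a" by (simp add: powr_add[symmetric])
  also have "\<dots> \<le> d powr (b - a) * x powr a"
    using assms by (intro mult_right_mono powr_mono2) auto
  finally show ?thesis .
qed (use assms in simp)

text \<open>
  With \<open>\<alpha> = 1 / 2\<close> the operator preserves the \<open>\<ell>\<^sub>2\<close>-norm, so the left-hand side is the sum of the squares \<open>F(k)\<^sup>2\<close>;
  weak boundedness bounds each \<open>F(k)\<close> by a constant, whence \<open>F(k)\<^sup>2 \<le> const * F(k)\<^sup>s\<close>.
\<close>
lemma weak_to_strong_into_l2:
  assumes s: "1 \<le> s" "s \<le> 2"
  shows "weak_to_strong s 2 1 (real DIM('a) powr (2 - s))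
    (had_op (1 / 2) :: (nat \<Rightarrow> 'a::{real_normed_field, euclidean_space}) \<Rightarrow> nat \<Rightarrow> 'a)"
  unfolding weak_to_strong_def
proof (intro allI impI)
  fix m :: nat and f :: "nat \<Rightarrow> nat \<Rightarrow> 'a" and K :: nat
  assume "(\<forall>i<m. psummable s (f i)) \<and>
     (\<forall>w. psum s (\<lambda>k. \<Sum>i<m. w i *\<^sub>R f i k) \<le> L2_set w {..<m} powr s)"
  then have ls: "\<And>i. i < m \<Longrightarrow> psummable s (f i)"
    and weak: "\<And>w. psum s (\<lambda>k. \<Sum>i<m. w i *\<^sub>R f i k) \<le> L2_set w {..<m} powr s"
    by auto
  let ?F = "\<lambda>k. L2_set (\<lambda>i. norm (f i k)) {..<m}"
  have smF: "summable (\<lambda>k. ?F k powr s)" by (rule square_function_summable) (use s ls in auto)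
  have "(\<Sum>l<K. L2_set (\<lambda>i. norm (had_op (1 / 2) (f i) l)) {..<m} powr 2)
      \<le> real DIM('a) powr (2 - s) * (\<Sum>k. ?F k powr s)"
  proof (rule sum_le_of_blocks)
    fix n :: nat assume n: "1 \<le> n"
    have "(\<Sum>l<2 ^ n. L2_set (\<lambda>i. norm (had_op (1 / 2) (f i) (block_start n + l))) {..<m} powr 2)
        = (\<Sum>k<2 ^ n. ?F (block_start n + k) powr 2)"
      by (simp add: powr_two square_function_half_isometry_block[OF n])
    also have "\<dots> \<le> (\<Sum>k<2 ^ n. real DIM('a) powr (2 - s) * ?F (block_start n + k) powr s)"
      by (intro sum_mono powr_le_of_bounded square_function_le_dim[OF s(1) ls weak]) (use s in auto)
    finally show "(\<Sum>l<2 ^ n. L2_set (\<lambda>i. norm (had_op (1 / 2) (f i) (block_start n + l))) {..<m} powr 2)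
        \<le> real DIM('a) powr (2 - s) * (\<Sum>k<2 ^ n. ?F (block_start n + k) powr s)"
      by (simp add: sum_distrib_left)
  qed (use smF in auto)
  moreover have "0 \<le> (\<Sum>k. ?F k powr s)" by (rule suminf_nonneg[OF smF]) simp
  ultimately show "(\<Sum>l<K. L2_set (\<lambda>i. norm (had_op (1 / 2) (f i) l)) {..<m} powr 2)
      \<le> real DIM('a) powr (2 - s) * (\<Sum>k. ?F k powr s) powr 1" by simp
qed

text \<open>
  The image of a tuple which is weakly bounded in \<open>\<ell>\<^sub>2\<close> is again weakly bounded in \<open>\<ell>\<^sub>2\<close>, because the operator is
  isometric. Hence \<open>G(l)\<close> is bounded by a constant and \<open>G(l)\<^sup>q \<le> const * G(l)\<^sup>2\<close>.
\<close>
lemma weak_to_strong_from_l2: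
  assumes q: "2 \<le> q"
  shows "weak_to_strong 2 q 1 (real DIM('a) powr (q - 2))
    (had_op (1 / 2) :: (nat \<Rightarrow> 'a::{real_normed_field, euclidean_space}) \<Rightarrow> nat \<Rightarrow> 'a)"
  unfolding weak_to_strong_def
proof (intro allI impI)
  fix m :: nat and f :: "nat \<Rightarrow> nat \<Rightarrow> 'a" and K :: nat
  assume "(\<forall>i<m. psummable 2 (f i)) \<and>
     (\<forall>w. psum 2 (\<lambda>k. \<Sum>i<m. w i *\<^sub>R f i k) \<le> L2_set w {..<m} powr 2)"
  then have ls: "\<And>i. i < m \<Longrightarrow> psummable 2 (f i)"
    and weak: "\<And>w. psum 2 (\<lambda>k. \<Sum>i<m. w i *\<^sub>R f i k) \<le> L2_set w {..<m} powr 2"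
    by auto
  let ?F = "\<lambda>k. L2_set (\<lambda>i. norm (f i k)) {..<m}"
  let ?G = "\<lambda>l. L2_set (\<lambda>i. norm (had_op (1 / 2) (f i) l)) {..<m}"
  have smF: "summable (\<lambda>k. ?F k powr 2)" by (rule square_function_summable) (use ls in auto)
  have pt: "norm (\<Sum>i<m. w i *\<^sub>R had_op (1 / 2) (f i) j) \<le> 1 * L2_set w {..<m}" for w j
  proof -
    define x where "x = (\<lambda>k. \<Sum>i<m. w i *\<^sub>R f i k)"
    have Tx: "had_op (1 / 2) x = (\<lambda>l. \<Sum>i<m. w i *\<^sub>R had_op (1 / 2) (f i) l)"
      unfolding x_def by (rule real_linearD[OF had_op_linear ls])
    obtain n l where nl: "1 \<le> n" "l < 2 ^ n" "j = block_start n + l"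
      using block_decomposition by blast
    have "(norm (had_op (1 / 2) x j))\<^sup>2 \<le> (\<Sum>l<2 ^ n. (norm (had_op (1 / 2) x (block_start n + l)))\<^sup>2)"
      unfolding nl(3)
      by (rule member_le_sum[of l "{..<2 ^ n}" "\<lambda>l. (norm (had_op (1 / 2) x (block_start n + l)))\<^sup>2"])
        (use nl in auto)
    also have "\<dots> = (\<Sum>k\<in>(+) (block_start n) ` {..<2 ^ n}. norm (x k) powr 2)"
      unfolding had_op_half_isometry_block[OF nl(1)] by (subst sum.reindex) (auto simp: powr_two)
    also have "\<dots> \<le> L2_set w {..<m} powr 2"
      unfolding x_def by (rule weak_finite_sum[OF _ ls weak]) auto
    finally have "(norm (had_op (1 / 2) x j))\<^sup>2 \<le> (L2_set w {..<m})\<^sup>2" by (simp add: powr_two)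
    then have "norm (had_op (1 / 2) x j) \<le> L2_set w {..<m}" by (rule power2_le_imp_le) simp
    then show ?thesis by (simp add: Tx)
  qed
  have Gd: "?G l \<le> real DIM('a)" for l
    using L2_set_le_of_dual_bound[OF _ _ pt[of _ l]] by simp
  have "(\<Sum>l<K. ?G l powr q) \<le> real DIM('a) powr (q - 2) * (\<Sum>k. ?F k powr 2)"
  proof (rule sum_le_of_blocks)
    fix n :: nat assume n: "1 \<le> n"
    have "(\<Sum>l<2 ^ n. ?G (block_start n + l) powr q)
        \<le> (\<Sum>l<2 ^ n. real DIM('a) powr (q - 2) * ?G (block_start n + l) powr 2)"
      by (intro sum_mono powr_le_of_bounded Gd) (use q in auto)
    also have "\<dots> = real DIM('a) powr (q - 2) * (\<Sum>k<2 ^ n. ?F (block_start n + k) powr 2)"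
      by (simp add: powr_two square_function_half_isometry_block[OF n] sum_distrib_left[symmetric])
    finally show "(\<Sum>l<2 ^ n. ?G (block_start n + l) powr q)
        \<le> real DIM('a) powr (q - 2) * (\<Sum>k<2 ^ n. ?F (block_start n + k) powr 2)" .
  qed (use smF in auto)
  moreover have "0 \<le> (\<Sum>k. ?F k powr 2)" by (rule suminf_nonneg[OF smF]) simp
  ultimately show "(\<Sum>l<K. ?G l powr q) \<le> real DIM('a) powr (q - 2) * (\<Sum>k. ?F k powr 2) powr 1"
    by simp
qed

section \<open>Exponents and sequence spaces\<close>

lemma psum_mono_exponent:
  assumes ps: "0 < P" "P \<le> s" and x: "psummable P x"
  shows "psummable s x" and "psum s x powr (1 / s) \<le> psum P x powr (1 / P)"
proof -
  define N where "N = psum P x powr (1 / P)"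
  have NP: "N powr P = psum P x" using ps psum_nonneg[OF x] by (simp add: N_def powr_powr)
  have xN: "norm (x k) \<le> N" for k
  proof (rule ccontr)
    assume "\<not> ?thesis"
    then have "N powr P < norm (x k) powr P" using ps by (intro powr_less_mono2) (auto simp: N_def)
    then show False using norm_powr_le_psum[OF x, of k] by (simp add: NP)
  qed
  have pw: "norm (x k) powr s \<le> N powr (s - P) * norm (x k) powr P" for k
    by (rule powr_le_of_bounded) (use xN ps in auto)
  have sm: "summable (\<lambda>k. N powr (s - P) * norm (x k) powr P)"
    using x unfolding psummable_def by (rule summable_mult)
  show s: "psummable s x"
    unfolding psummable_def by (rule summable_comparison_test'[OF sm]) (use pw in auto)
  have "psum s x \<le> (\<Sum>k. N powr (s - P) * norm (x k) powr P)"
    unfolding psum_def using s sm by (intro suminf_le pw) (auto simp: psummable_def)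
  also have "\<dots> = N powr (s - P) * N powr P"
    unfolding NP using x by (simp add: psum_def psummable_def suminf_mult)
  also have "\<dots> = N powr s" by (simp flip: powr_add)
  finally have "psum s x powr (1 / s) \<le> (N powr s) powr (1 / s)"
    using ps psum_nonneg[OF s] by (intro powr_mono2) auto
  then show "psum s x powr (1 / s) \<le> psum P x powr (1 / P)"
    using ps by (simp add: powr_powr N_def)
qed

lemma lp_space_finite:
  assumes "p \<noteq> \<infinity>"
  shows "x \<in> lp_space p \<longleftrightarrow> psummable (enn2real p) x"
    "lp_norm p x = psum (enn2real p) x powr (1 / enn2real p)"
  using assms by (auto simp: lp_space_def lp_norm_def psummable_def psum_def)

lemma lp_space_supset:
  assumes q': "0 < q'" and le: "q = \<infinity> \<or> q' \<le> enn2real q" and y: "psummable q' y"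
  shows "y \<in> lp_space q" and "lp_norm q y \<le> psum q' y powr (1 / q')"
proof -
  have "y \<in> lp_space q \<and> lp_norm q y \<le> psum q' y powr (1 / q')"
  proof (cases "q = \<infinity>")
    case True
    have bd: "norm (y k) \<le> psum q' y powr (1 / q')" for k
    proof -
      have "(norm (y k) powr q') powr (1 / q') \<le> psum q' y powr (1 / q')"
        using q' norm_powr_le_psum[OF y] by (intro powr_mono2) auto
      then show ?thesis using q' by (simp add: powr_powr)
    qed
    then have "bounded (range y)" by (intro boundedI) auto
    moreover have "(SUP k. norm (y k)) \<le> psum q' y powr (1 / q')" by (intro cSUP_least bd) auto
    ultimately show ?thesis using True by (simp add: lp_space_def lp_norm_def)
  next
    case False
    then show ?thesis
      using psum_mono_exponent[OF q' _ y, of "enn2real q"] le by (simp add: lp_space_finite)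
  qed
  then show "y \<in> lp_space q" "lp_norm q y \<le> psum q' y powr (1 / q')" by auto
qed

lemma lp_norm_nonneg:
  assumes "y \<in> lp_space q" shows "0 \<le> lp_norm q y"
proof (cases "q = \<infinity>")
  case True
  then have "bdd_above (range (\<lambda>k. norm (y k)))"
    using assms by (auto simp: lp_space_def bounded_iff bdd_above_def)
  then have "norm (y 0) \<le> (SUP k. norm (y k))" by (intro cSUP_upper) auto
  then show ?thesis using True norm_ge_zero[of "y 0"] unfolding lp_norm_def by (simp del: norm_ge_zero)
qed (simp add: lp_norm_def)

lemma ennreal_one_divide_antimono: "a \<le> b \<Longrightarrow> 1 / b \<le> 1 / (a::ennreal)"
  by (simp add: divide_ennreal_def less_eq_ennreal.rep_eq inverse_ennreal.rep_eq ereal_inverse_antimono)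

lemma ennreal_one_divide_min: "1 / min a b = max (1 / a) (1 / (b::ennreal))"
  using ennreal_one_divide_antimono[of a b] ennreal_one_divide_antimono[of b a]
  by (auto simp: min_def max_def)

text \<open>
  The reciprocal of the minimum is the maximum of the reciprocals, which stays meaningful for \<open>q = \<infinity>\<close> and for
  \<open>p = 1\<close>, where \<open>p' = \<infinity>\<close>.
\<close>
lemma hadamard_exponent:
  assumes "1 \<le> p" "p \<noteq> \<infinity>" "1 \<le> q"
  shows "enn2real (1 / min (conj_exponent p) q) = max (1 - 1 / enn2real p) (enn2real (1 / q))"
proof -
  obtain P where P: "p = ennreal P" "0 \<le> P" using assms(2) by (cases p) auto
  have P1: "1 \<le> P" using assms(1) P by (simp flip: ennreal_1)
  have "1 / p = ennreal (1 / P)" using P P1 by (simp add: divide_ennreal flip: ennreal_1)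
  then have "1 / conj_exponent p = ennreal 1 - ennreal (1 / P)"
    by (simp add: conj_exponent_def)
  also have "\<dots> = ennreal (1 - 1 / P)" using P1 by (subst ennreal_minus) auto
  finally have cp: "1 / conj_exponent p = ennreal (1 - 1 / P)" .
  have "1 / q \<le> 1 / 1" using assms(3) by (rule ennreal_one_divide_antimono)
  then have "1 / q \<noteq> \<infinity>" by (auto simp: top_unique)
  then obtain \<beta> where \<beta>: "1 / q = ennreal \<beta>" "0 \<le> \<beta>" by (cases "1 / q") auto
  have mx: "max (ennreal (1 - 1 / P)) (ennreal \<beta>) = ennreal (max (1 - 1 / P) \<beta>)"
    using P1 \<beta> by (auto simp: max_def)
  show ?thesis
    unfolding ennreal_one_divide_min cp \<beta>(1) mx using P P1 \<beta> by (auto simp: max_def)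
qed

lemma had_op_add: "had_op \<alpha> (x + y) = had_op \<alpha> x + had_op \<alpha> y"
  by (rule ext) (simp add: had_op_def Let_def distrib_left sum.distrib scaleR_add_right)

lemma had_op_scale:
  fixes x :: "nat \<Rightarrow> 'a::real_normed_field"
  shows "had_op \<alpha> (seq_scale c x) = seq_scale c (had_op \<alpha> x)"
proof
  fix i
  have "(\<Sum>k<n. h k * (c * y k)) = c * (\<Sum>k<n. h k * y k)" for n :: nat and h y :: "nat \<Rightarrow> 'a"
    by (simp add: sum_distrib_left mult.left_commute)
  then show "had_op \<alpha> (seq_scale c x) i = seq_scale c (had_op \<alpha> x) i"
    by (simp add: had_op_def Let_def seq_scale_def)
qed

text \<open>
  If \<open>\<alpha> < 1/2\<close>, the operator is considered from \<open>\<ell>\<^sub>s\<close> to \<open>\<ell>\<^sub>r\<close> with \<open>r = 1 / \<alpha>\<close> and \<open>s\<close> conjugate to it; then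
  \<open>r / s > \<kappa>\<close> reads \<open>(r - 1) (r - 2) > 0\<close>. If \<open>\<alpha> = 1/2\<close>, then \<open>q = 2\<close> and \<open>p < 2\<close>, or \<open>p = 2\<close> and \<open>q > 2\<close>. The
  excluded pair \<open>p = 1\<close>, \<open>q = \<infinity>\<close> is the one with \<open>\<alpha> = 0\<close>.
\<close>
lemma intermediate_exponents:
  fixes p q :: ennreal
  assumes pq: "1 \<le> p" "p \<le> 2" "2 \<le> q" "\<not> (p = 2 \<and> q = 2)" "\<not> (p = 1 \<and> q = \<infinity>)"
  defines "\<alpha> \<equiv> enn2real (1 / min (conj_exponent p) q)"
  obtains s q' \<kappa> C where "1 \<le> s" "s \<le> 2" "2 \<le> q'" "0 \<le> C" "0 \<le> \<kappa>" "\<kappa> < q' / s"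
    "0 < enn2real p" "enn2real p \<le> s" "q = \<infinity> \<or> q' \<le> enn2real q"
    "weak_to_strong s q' \<kappa> C (had_op \<alpha> :: (nat \<Rightarrow> 'a::{real_normed_field, euclidean_space}) \<Rightarrow> nat \<Rightarrow> 'a)"
proof -
  have pfin: "p \<noteq> \<infinity>" using pq(2) by (auto simp: top_unique)
  then obtain P where P: "p = ennreal P" "0 \<le> P" by (cases p) auto
  have eP: "enn2real p = P" using P by simp
  have P12: "1 \<le> P" "P \<le> 2"
    using pq(1,2) P by (simp_all flip: ennreal_1 ennreal_numeral)
  define \<beta> where "\<beta> = enn2real (1 / q)"
  have \<alpha>: "\<alpha> = max (1 - 1 / P) \<beta>"
    unfolding \<alpha>_def \<beta>_def using hadamard_exponent[OF pq(1) pfin] pq(3) eP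
    by (metis one_le_numeral order_trans)
  have q_cases: "(q = \<infinity> \<and> \<beta> = 0) \<or> (q \<noteq> \<infinity> \<and> 2 \<le> enn2real q \<and> \<beta> = 1 / enn2real q)"
  proof (cases q)
    case (real Q)
    then have "2 \<le> Q" using pq(3) by (simp flip: ennreal_numeral)
    then show ?thesis using real by (simp add: \<beta>_def divide_ennreal flip: ennreal_1)
  qed (simp add: \<beta>_def)
  have \<beta>: "0 \<le> \<beta>" "\<beta> \<le> 1 / 2" using q_cases by (auto simp: field_simps)
  have \<alpha>2: "\<alpha> \<le> 1 / 2" 
  proof -
    have "1 - 1 / P \<le> 1 / 2" using P12 by (simp add: field_simps)
    then show ?thesis unfolding \<alpha> using \<beta>(2) by (rule max.boundedI)
  qed
  have P0: "0 < enn2real p" using P12 eP by simp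
  show ?thesis
  proof (cases "\<alpha> < 1 / 2")
    case True
    have \<alpha>0: "0 < \<alpha>"
    proof (rule ccontr)
      assume "\<not> 0 < \<alpha>"
      then have "1 - 1 / P \<le> 0" "\<beta> = 0" using \<beta> by (auto simp: \<alpha>)
      then have "P = 1" "q = \<infinity>" using P12 q_cases by (auto simp: field_simps)
      then show False using pq(5) P by simp
    qed
    define r where "r = 1 / \<alpha>"
    have r: "2 < r" "1 / r = \<alpha>" using True \<alpha>0 by (auto simp: r_def field_simps)
    show ?thesis
    proof (rule that[where s="r / (r - 1)" and q'=r and \<kappa>="2 - 2 / r"])
      show "weak_to_strong (r / (r - 1)) r (2 - 2 / r) (4 * (2 * real DIM('a)) powr (r - 2))
          (had_op \<alpha> :: (nat \<Rightarrow> 'a) \<Rightarrow> nat \<Rightarrow> 'a)"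
        using weak_to_strong_dual_exponents[OF r(1), where ?'a='a] by (simp add: r(2))
      have "(r - 1) * 2 < (r - 1) * r" using r(1) by (intro mult_strict_left_mono) auto
      then have "(r - 1) * 2 / r < r - 1" using r(1) by (simp add: pos_divide_less_eq)
      moreover have "2 - 2 / r = (r - 1) * 2 / r" "r / (r / (r - 1)) = r - 1"
        using r(1) by (auto simp: field_simps)
      ultimately show "2 - 2 / r < r / (r / (r - 1))" by simp
      have "1 - 1 / P \<le> 1 / r" using r(2) \<alpha> by simp
      then have "P * (r - 1) \<le> r" using P12 r(1) by (simp add: field_simps)
      then show "enn2real p \<le> r / (r - 1)" using r(1) by (simp add: eP field_simps)
      show "q = \<infinity> \<or> r \<le> enn2real q"
      proof (cases "q = \<infinity>")
        case False
        then have q2: "2 \<le> enn2real q" "\<beta> = 1 / enn2real q" using q_cases by auto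
        have "\<beta> \<le> 1 / r" using r(2) \<alpha> by simp
        then show ?thesis using q2 r(1) by (simp add: field_simps)
      qed simp
    qed (use r P0 in \<open>auto simp: field_simps\<close>)
  next
    case False
    then have \<alpha>h: "\<alpha> = 1 / 2" using \<alpha>2 by simp
    show ?thesis
    proof (cases "\<beta> = 1 / 2")
      case True
      then have q: "q \<noteq> \<infinity>" "enn2real q = 2" using q_cases by (auto simp: field_simps)
      then have "q = 2" by (simp only: enn2real_eq_posreal_iff) simp
      then have "P \<noteq> 2" using pq(4) P by auto
      then have P2: "P < 2" using P12 by simp
      show ?thesis
      proof (rule that[where s=P and q'=2 and \<kappa>=1])
        show "weak_to_strong P 2 1 (real DIM('a) powr (2 - P))
            (had_op \<alpha> :: (nat \<Rightarrow> 'a) \<Rightarrow> nat \<Rightarrow> 'a)"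
          unfolding \<alpha>h by (rule weak_to_strong_into_l2) (use P12 in auto)
      qed (use P12 P2 eP q in auto)
    next
      case False
      then have "1 - 1 / P = 1 / 2" using \<alpha>h \<alpha> by (auto simp: max_def split: if_splits)
      then have P2: "P = 2" using P12 by (simp add: field_simps)
      \<comment> \<open>Any finite exponent above \<open>2\<close> serves if \<open>q = \<infinity>\<close>.\<close>
      define q' where "q' = (if q = \<infinity> then 3 else enn2real q)"
      have q': "2 < q'" "q = \<infinity> \<or> q' \<le> enn2real q"
        using q_cases False by (auto simp: q'_def less_le)
      show ?thesis
      proof (rule that[where s=2 and q'=q' and \<kappa>=1])
        show "weak_to_strong 2 q' 1 (real DIM('a) powr (q' - 2))
            (had_op \<alpha> :: (nat \<Rightarrow> 'a) \<Rightarrow> nat \<Rightarrow> 'a)"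
          unfolding \<alpha>h by (rule weak_to_strong_from_l2) (use q' in auto)
      qed (use P2 eP q' in auto)
    qed
  qed
qed

theorem theorem6p8:
  fixes p q :: ennreal
  assumes "1 \<le> p" and "p \<le> 2" and "2 \<le> q"
    and "\<not> (p = 2 \<and> q = 2)" and "\<not> (p = 1 \<and> q = \<infinity>)"
  shows "finitely_strictly_singular (lp_space p) (lp_norm p) (lp_space q) (lp_norm q)
    (block_hadamard p q :: (nat \<Rightarrow> 'a::{real_normed_field, euclidean_space}) \<Rightarrow> nat \<Rightarrow> 'a)"
proof -
  define U :: "(nat \<Rightarrow> 'a) \<Rightarrow> nat \<Rightarrow> 'a" where "U = block_hadamard p q"
  define \<alpha> where "\<alpha> = enn2real (1 / min (conj_exponent p) q)"
  have U: "U = had_op \<alpha>" unfolding U_def \<alpha>_def by (rule block_hadamard_eq_had_op)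
  obtain s q' \<kappa> C where s: "1 \<le> s" "s \<le> 2" "2 \<le> q'" "0 \<le> C" "0 \<le> \<kappa>" "\<kappa> < q' / s"
    and P: "0 < enn2real p" "enn2real p \<le> s" and q': "q = \<infinity> \<or> q' \<le> enn2real q"
    and wts: "weak_to_strong s q' \<kappa> C U"
    unfolding U \<alpha>_def by (rule intermediate_exponents[OF assms, where ?'a='a])
  have lin: "real_linear_on_psummable s U" unfolding U by (rule had_op_linear)
  have pfin: "p \<noteq> \<infinity>" using assms(2) by (auto simp: top_unique)
  have xs: "psummable s x" and xle: "psum s x powr (1 / s) \<le> lp_norm p x"
    if "x \<in> lp_space p" for x :: "nat \<Rightarrow> 'a"
    using psum_mono_exponent[OF P, of x] that pfin by (auto simp: lp_space_finite)
  have Ux: "psummable q' (U x)" if "x \<in> lp_space p" for x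
    by (rule weak_to_strong_imp_bounded(1)[OF lin wts _ _ _ _ xs[OF that]]) (use s in auto)
  have Uq: "U x \<in> lp_space q" and Ule: "lp_norm q (U x) \<le> psum q' (U x) powr (1 / q')"
    if "x \<in> lp_space p" for x
    using lp_space_supset[OF _ q' Ux[OF that]] s by auto
  have bounded: "lp_norm q (U x) \<le> C powr (1 / q') * lp_norm p x" if x: "x \<in> lp_space p" for x
  proof -
    have "lp_norm q (U x) \<le> C powr (1 / q') * psum s x powr (1 / s)"
      using Ule[OF x] weak_to_strong_imp_bounded(2)[OF lin wts _ _ _ _ xs[OF x]] s by linarith
    also have "\<dots> \<le> C powr (1 / q') * lp_norm p x" by (intro mult_left_mono xle x) auto
    finally show ?thesis .
  qed
  have small: "\<exists>n\<ge>1. \<forall>E. seq.subspace E \<and> E \<subseteq> lp_space p \<and> seq.dim E = n \<longrightarrow>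
      (INF x\<in>{x\<in>E. lp_norm p x = 1}. lp_norm q (U x)) < \<epsilon>" if \<epsilon>: "0 < \<epsilon>" for \<epsilon>
  proof -
    obtain n where n: "1 \<le> n" "\<forall>E. seq.subspace E \<and> seq.dim E = n \<and> (\<forall>x\<in>E. psummable s x) \<longrightarrow>
       (\<exists>x\<in>E. 0 < psum s x \<and> psum q' (U x) powr (1 / q') \<le> \<epsilon> / 2 * psum s x powr (1 / s))"
      using weak_to_strong_imp_fss[OF lin wts s, of "\<epsilon> / 2"] \<epsilon> by auto
    show ?thesis
    proof (intro exI[of _ n] conjI n(1) allI impI)
      fix E :: "(nat \<Rightarrow> 'a) set"
      assume "seq.subspace E \<and> E \<subseteq> lp_space p \<and> seq.dim E = n"
      then have E: "seq.subspace E" "E \<subseteq> lp_space p" "seq.dim E = n" by auto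
      then obtain x where x: "x \<in> E" "0 < psum s x"
        "psum q' (U x) powr (1 / q') \<le> \<epsilon> / 2 * psum s x powr (1 / s)"
        using n(2) xs by blast
      have xp: "x \<in> lp_space p" using x E by auto
      define N where "N = lp_norm p x"
      have "0 < psum s x powr (1 / s)" using x by simp
      then have N: "0 < N" unfolding N_def using xle[OF xp] by linarith
      define y where "y = seq_scale (of_real (1 / N)) x"
      have y: "y = (\<lambda>k. (1 / N) *\<^sub>R x k)" by (simp add: y_def seq_scale_def scaleR_conv_of_real)
      have yE: "y \<in> E" unfolding y_def by (rule seq.subspace_scale[OF E(1) x(1)])
      then have yp: "y \<in> lp_space p" using E by auto
      have y1: "lp_norm p y = 1"
      proof -
        have xP: "psummable (enn2real p) x" using xp pfin by (simp add: lp_space_finite)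
        have "lp_norm p y = (\<bar>1 / N\<bar> powr enn2real p * psum (enn2real p) x) powr (1 / enn2real p)"
          using pfin psum_scale(2)[OF xP, of "1 / N"] by (simp add: lp_space_finite y)
        also have "\<dots> = 1 / N * N"
          using N P pfin psum_nonneg[OF xP] by (simp add: powr_mult powr_powr N_def lp_space_finite)
        finally show ?thesis using N by simp
      qed
      have Uy_eq: "U y = (\<lambda>l. (1 / N) *\<^sub>R U x l)"
        unfolding y_def U had_op_scale by (simp add: seq_scale_def scaleR_conv_of_real)
      have "lp_norm q (U y) \<le> psum q' (U y) powr (1 / q')" by (rule Ule[OF yp])
      also have "\<dots> = 1 / N * psum q' (U x) powr (1 / q')"
        unfolding Uy_eq using N s psum_scale(2)[OF Ux[OF xp], of "1 / N"] psum_nonneg[OF Ux[OF xp]]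
        by (simp add: powr_mult powr_powr)
      also have "\<dots> \<le> 1 / N * (\<epsilon> / 2 * N)"
        using x(3) xle[OF xp] N \<epsilon> unfolding N_def[symmetric]
        by (intro mult_left_mono order_trans[OF x(3)]) auto
      finally have Uy: "lp_norm q (U y) \<le> \<epsilon> / 2" using N by simp
      have "(INF x\<in>{x\<in>E. lp_norm p x = 1}. lp_norm q (U x)) \<le> lp_norm q (U y)"
      proof (rule cINF_lower)
        show "bdd_below ((\<lambda>x. lp_norm q (U x)) ` {x \<in> E. lp_norm p x = 1})"
          using E Uq lp_norm_nonneg by (intro bdd_belowI2[of _ 0]) auto
      qed (use yE y1 in simp)
      then show "(INF x\<in>{x\<in>E. lp_norm p x = 1}. lp_norm q (U x)) < \<epsilon>" using Uy \<epsilon> by linarith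
    qed
  qed
  have "bounded_operator (lp_space p) (lp_norm p) (lp_space q) (lp_norm q) U"
    unfolding bounded_operator_def
    using Uq bounded by (auto simp: U had_op_add had_op_scale)
  then have "finitely_strictly_singular (lp_space p) (lp_norm p) (lp_space q) (lp_norm q) U"
    unfolding finitely_strictly_singular_def using small by blast
  then show ?thesis by (simp only: U_def)
qed

end
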